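(* For $m>0$, $H>0$, $p\ge 0$ let $T_{SJ}(p)$ be the effective temperature of the S-J vacuum of a scalar field of mass $m$ in the radiation era, at Hubble parameter $H$ and physical momentum $p$, as defined in the context. In the regime $m\ll H$ and $p\ll\sqrt{mH}$ one has $$T_{SJ}(p)\sim\frac{\pi}{4\,|\Gamma(3/4)|^2}\,\frac{H^{3/2}}{\sqrt m},$$ that is, the ratio of the two sides tends to $1$ as $m/H\to0$ and $p/\sqrt{mH}\to0$.
   Context: Put $z=i\frac{m}{H}$, $\lambda=\frac{-ip^2}{4mH}$, $\mu=\frac14$, and let $W_{\lambda,\mu}$ be the standard (principal branch) Whittaker function, i.e. the solution of $W''+\left(-\frac14+\frac{\lambda}{z}+\frac{\frac14-\mu^2}{z^2}\right)W=0$ with $W_{\lambda,\mu}(z)\sim e^{-z/2}z^{\lambda}$ as $z\to\infty$, $|\arg z|<\frac{3\pi}{2}$. Define the occupation number $$n_{SJ}=\frac14\,\frac{e^{-i\pi\lambda}}{\sqrt{\frac{p^2}{m^2}+1}}\left\{\left(\frac{p^2}{m^2}+1\right)|W_{\lambda,\mu}(z)|^2-\frac{1}{z^2}\left|2z\frac{dW_{\lambda,\mu}(z)}{dz}-\frac32W_{\lambda,\mu}(z)\right|^2\right\}-\frac12$$ (note that $e^{-i\pi\lambda}=e^{-\pi p^2/(4mH)}$ and $-1/z^2=H^2/m^2$ are real and positive), and the effective temperature $$T_{SJ}(p)=\frac{\sqrt{p^2+m^2}}{\ln\left(1+\frac{1}{n_{SJ}}\right)} .$$ *)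

theory Defs
  imports "HOL-Analysis.Analysis"
begin

text \<open>
  The sector \<open>\<bar>arg z\<bar> < 3\<pi>/2\<close> overlaps itself in the plane, so the asymptotic condition is
  imposed on the continuation \<open>F\<close> of the principal branch \<open>W\<close> to the Riemann surface of
  the logarithm, in the coordinate \<open>\<zeta> = log z\<close>: there \<open>\<bar>z\<bar> \<rightarrow> \<infinity>\<close> is \<open>Re \<zeta> \<rightarrow> \<infinity>\<close>,
  \<open>arg z = Im \<zeta>\<close> and \<open>z\<close> to the power \<open>\<kappa>\<close> is \<open>exp (\<kappa> * \<zeta>)\<close>. As usual for such expansions,
  the limit is uniform on closed subsectors; it fails to be uniform on the whole open sector.
\<close>

definition is_whittaker_W :: "complex \<Rightarrow> complex \<Rightarrow> (complex \<Rightarrow> complex) \<Rightarrow> bool" where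
  "is_whittaker_W \<kappa> \<mu> W \<longleftrightarrow>
     W holomorphic_on (- \<real>\<^sub>\<le>\<^sub>0) \<and>
     (\<forall>z. z \<notin> \<real>\<^sub>\<le>\<^sub>0 \<longrightarrow>
        deriv (deriv W) z + (- 1 / 4 + \<kappa> / z + (1 / 4 - \<mu>\<^sup>2) / z\<^sup>2) * W z = 0) \<and>
     (\<exists>F. F holomorphic_on {\<zeta>. \<bar>Im \<zeta>\<bar> < 3 * pi / 2} \<and>
          (\<forall>\<zeta>. \<bar>Im \<zeta>\<bar> < pi \<longrightarrow> F \<zeta> = W (exp \<zeta>)) \<and>
          (\<forall>\<delta>>0. ((\<lambda>\<zeta>. F \<zeta> / (exp (- exp \<zeta> / 2) * exp (\<kappa> * \<zeta>))) \<longlongrightarrow> 1)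
             (inf (filtercomap Re at_top) (principal {\<zeta>. \<bar>Im \<zeta>\<bar> \<le> 3 * pi / 2 - \<delta>}))))"

text \<open>
  The conditions determine \<open>W\<close> on the slit plane, since \<open>W\<close> is the recessive solution along
  the positive real axis; only the irrelevant values on the cut depend on the choice.
\<close>

definition whittaker_W :: "complex \<Rightarrow> complex \<Rightarrow> complex \<Rightarrow> complex" where
  "whittaker_W \<kappa> \<mu> = (SOME W. is_whittaker_W \<kappa> \<mu> W)"

text \<open>
  The expression under \<open>Re\<close> is real, because \<open>exp (- \<i> * pi * \<kappa>)\<close> and \<open>- 1 / z\<^sup>2\<close> are.
\<close>

definition n_SJ :: "real \<Rightarrow> real \<Rightarrow> real \<Rightarrow> real" where
  "n_SJ m H p =
     (let z = \<i> * of_real (m / H);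
          \<kappa> = - \<i> * of_real (p\<^sup>2 / (4 * m * H));
          W = whittaker_W \<kappa> (1 / 4)
      in Re (1 / 4 * (exp (- \<i> * of_real pi * \<kappa>) / of_real (sqrt (p\<^sup>2 / m\<^sup>2 + 1))) *
             (of_real ((p\<^sup>2 / m\<^sup>2 + 1) * (cmod (W z))\<^sup>2)
              - 1 / z\<^sup>2 * of_real ((cmod (2 * z * deriv W z - 3 / 2 * W z))\<^sup>2))
             - 1 / 2))"

definition T_SJ :: "real \<Rightarrow> real \<Rightarrow> real \<Rightarrow> real" where
  "T_SJ m H p = sqrt (p\<^sup>2 + m\<^sup>2) / ln (1 + 1 / n_SJ m H p)"

end

theory Submission
  imports Defs "HOL-Complex_Analysis.Complex_Analysis" "HOL-Real_Asymp.Real_Asymp"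
begin

text \<open>
  With \<open>x = m/H\<close>, \<open>s = p\<^sup>2/(4mH)\<close>, \<open>\<kappa> = -is\<close>, \<open>a = 3/4 - \<kappa>\<close>, \<open>c = 1/4 - \<kappa>\<close> one has
  \<open>W(z) = exp(-z/2) z\<^bsup>1/4\<^esup> v(z) / \<Gamma>(a)\<close> with \<open>v(z) = \<integral>\<^sub>0\<^sup>\<infinity> exp(-t) t\<^bsup>a-1\<^esup> (t + z)\<^bsup>-c\<^esup> dt\<close>.
  Rotating the ray of integration continues this to \<open>\<bar>arg z\<bar> < 3\<pi>/2\<close>, where dominated convergence
  gives the asymptotics at infinity, so a Whittaker function exists; it is unique because it is
  recessive. As \<open>z = ix \<rightarrow> 0\<close> and \<open>\<kappa> \<rightarrow> 0\<close>, dominated convergence gives \<open>v(z) \<rightarrow> \<Gamma>(1/2)\<close> and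
  \<open>z v'(z) \<rightarrow> 0\<close>. Since \<open>2zW' - 3W/2\<close> equals \<open>-exp(-z/2) z\<^bsup>1/4\<^esup> ((z + 1) v - 2 z v') / \<Gamma>(a)\<close>, it dominates the
  occupation number, which is asymptotic to \<open>\<pi> / (4 \<Gamma>(3/4)\<^sup>2 x sqrt(4s + x))\<close> and tends to infinity,
  so that \<open>ln(1 + 1/n)\<close> is asymptotic to \<open>1/n\<close>.
\<close>

section \<open>Parametric integrals\<close>

text \<open>Cauchy's estimate turns the majorant \<open>g\<close> of the values into a majorant of
  the derivatives on a smaller ball, hence of the difference quotients there; dominated convergence
  then applies.\<close>

lemma has_field_derivative_parametric_integral:
  fixes f :: "'a \<Rightarrow> complex \<Rightarrow> complex"
  assumes r: "0 < r"
    and meas: "\<And>\<zeta>. \<zeta> \<in> ball \<zeta>0 r \<Longrightarrow> (\<lambda>t. f t \<zeta>) \<in> borel_measurable M"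
    and hol: "\<And>t. f t holomorphic_on ball \<zeta>0 r"
    and bound: "\<And>t \<zeta>. \<zeta> \<in> ball \<zeta>0 r \<Longrightarrow> norm (f t \<zeta>) \<le> g t"
    and g: "integrable M g"
  shows "((\<lambda>\<zeta>. \<integral>t. f t \<zeta> \<partial>M) has_field_derivative (\<integral>t. deriv (f t) \<zeta>0 \<partial>M)) (at \<zeta>0)"
proof -
  have int: "integrable M (\<lambda>t. f t \<zeta>)" if "\<zeta> \<in> ball \<zeta>0 r" for \<zeta>
    by (rule Bochner_Integration.integrable_bound[OF g meas[OF that]])
       (intro AE_I2 order_trans[OF bound[OF that]], simp)
  \<comment> \<open>A disc of radius \<open>r/4\<close> about a point of the half ball stays in the
    full ball; this is the source of the constant 4.\<close>
  have der: "norm (deriv (f t) \<zeta>) \<le> 4 * g t / r" if "\<zeta> \<in> ball \<zeta>0 (r/2)" for t \<zeta>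
  proof -
    have sub: "cball \<zeta> (r/4) \<subseteq> ball \<zeta>0 r"
      using that r by (auto simp: subset_iff) (smt (verit) dist_triangle field_sum_of_halves)
    have "norm ((deriv ^^ 1) (f t) \<zeta>) \<le> fact 1 * g t / (r/4) ^ 1"
    proof (rule Cauchy_inequality)
      show "f t holomorphic_on ball \<zeta> (r/4)"
        by (rule holomorphic_on_subset[OF hol]) (use sub ball_subset_cball in blast)
      show "continuous_on (cball \<zeta> (r/4)) (f t)"
        by (intro holomorphic_on_imp_continuous_on holomorphic_on_subset[OF hol sub])
      show "norm (f t x) \<le> g t" if "norm (\<zeta> - x) = r/4" for x
        by (rule bound) (use sub that in \<open>auto simp: dist_norm subset_iff\<close>)
    qed (use r in auto)
    then show ?thesis by (simp add: field_simps)
  qed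
  define Q where "Q = (\<lambda>t h. (f t (\<zeta>0 + h) - f t \<zeta>0) / h)"
  have mem: "\<zeta>0 + h \<in> ball \<zeta>0 (r/2)" "\<zeta>0 + h \<in> ball \<zeta>0 r" if "h \<in> ball 0 (r/2)" for h
    using that r by (auto simp: dist_norm)
  have Qb: "norm (Q t h) \<le> 4 * g t / r" if "h \<in> ball 0 (r/2)" "h \<noteq> 0" for t h
  proof -
    have "norm (f t (\<zeta>0 + h) - f t \<zeta>0) \<le> (4 * g t / r) * norm (\<zeta>0 + h - \<zeta>0)"
    proof (rule field_differentiable_bound[where S = "ball \<zeta>0 (r/2)"])
      show "(f t has_field_derivative deriv (f t) z) (at z within ball \<zeta>0 (r/2))"
        if "z \<in> ball \<zeta>0 (r/2)" for z
        by (rule has_field_derivative_at_within, rule holomorphic_derivI[OF hol])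
           (use that r in auto)
      show "\<zeta>0 \<in> ball \<zeta>0 (r/2)" using r by simp
    qed (use der mem(1)[OF that(1)] in auto)
    then show ?thesis using that by (simp add: Q_def norm_divide divide_le_eq)
  qed
  have Qm: "(\<lambda>t. Q t h) \<in> borel_measurable M" if "h \<in> ball 0 (r/2)" for h
    unfolding Q_def using meas[OF mem(2)[OF that]] meas[of \<zeta>0] r by simp
  have Ql: "((\<lambda>h. Q t h) \<longlongrightarrow> deriv (f t) \<zeta>0) (at 0 within ball 0 (r/2))" for t
  proof -
    have "(f t has_field_derivative deriv (f t) \<zeta>0) (at \<zeta>0)"
      by (rule holomorphic_derivI[OF hol]) (use r in auto)
    then show ?thesis unfolding DERIV_def Q_def by (rule filterlim_mono) (auto simp: at_le)
  qed
  have g': "integrable M (\<lambda>t. 4 * g t / r)" using g by simp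
  have lim: "(\<lambda>n. Q t (X n)) \<longlonglongrightarrow> deriv (f t) \<zeta>0"
    if "\<And>n. X n \<in> ball 0 (r/2) - {0}" "X \<longlonglongrightarrow> 0" for X t
    using Ql[of t] that unfolding tendsto_at_iff_sequentially by (auto simp: o_def)
  \<comment> \<open>The derivative is measurable in \<open>t\<close> as a pointwise limit of
    measurable difference quotients.\<close>
  have dm: "(\<lambda>t. deriv (f t) \<zeta>0) \<in> borel_measurable M"
  proof (rule borel_measurable_LIMSEQ_metric)
    define X where "X n = complex_of_real (r / 4 / real (Suc n))" for n
    have X: "X n \<in> ball 0 (r/2) - {0}" for n
    proof -
      have "r / 4 / real (Suc n) \<le> r / 4 / 1" using r by (intro divide_left_mono) auto
      moreover define d where "d = r / 4 / real (Suc n)"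
      ultimately have "0 < d" "d < r / 2" using r by (simp add: d_def, linarith)
      then show ?thesis unfolding X_def d_def[symmetric] by simp
    qed
    show "(\<lambda>t. Q t (X n)) \<in> borel_measurable M" for n using Qm X by blast
    have "(\<lambda>n. r / 4 / real (Suc n)) \<longlonglongrightarrow> 0" by real_asymp
    then have "X \<longlonglongrightarrow> 0" unfolding X_def by (metis tendsto_of_real of_real_0)
    then show "(\<lambda>n. Q t (X n)) \<longlonglongrightarrow> deriv (f t) \<zeta>0" for t using lim X by blast
  qed
  have "((\<lambda>h. \<integral>t. Q t h \<partial>M) \<longlongrightarrow> (\<integral>t. deriv (f t) \<zeta>0 \<partial>M)) (at 0 within ball 0 (r/2))"
    unfolding tendsto_at_iff_sequentially o_def
  proof (intro allI impI)
    fix X assume X: "\<forall>i. X i \<in> ball 0 (r/2) - {0 :: complex}" "X \<longlonglongrightarrow> 0"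
    show "(\<lambda>n. \<integral>t. Q t (X n) \<partial>M) \<longlonglongrightarrow> (\<integral>t. deriv (f t) \<zeta>0 \<partial>M)"
    proof (rule integral_dominated_convergence[OF dm _ g'])
      show "(\<lambda>t. Q t (X i)) \<in> borel_measurable M" for i using Qm X by blast
      show "AE t in M. (\<lambda>i. Q t (X i)) \<longlonglongrightarrow> deriv (f t) \<zeta>0" using lim X by blast
      show "AE t in M. norm (Q t (X i)) \<le> 4 * g t / r" for i using Qb X by blast
    qed
  qed
  then have "((\<lambda>h. \<integral>t. Q t h \<partial>M) \<longlongrightarrow> (\<integral>t. deriv (f t) \<zeta>0 \<partial>M)) (at 0)"
    using r by (simp add: at_within_open[of 0 "ball 0 (r/2)"])
  moreover have "\<forall>\<^sub>F h in at 0. (\<integral>t. Q t h \<partial>M) = ((\<integral>t. f t (\<zeta>0 + h) \<partial>M) - (\<integral>t. f t \<zeta>0 \<partial>M)) / h"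
  proof -
    have "\<forall>\<^sub>F h in at 0. h \<in> ball 0 (r/2)"
      using r by (intro eventually_at_in_open') auto
    then show ?thesis
    proof eventually_elim
      case (elim h)
      then show ?case unfolding Q_def
        using int[OF mem(2)[OF elim]] int[of \<zeta>0] r by simp
    qed
  qed
  ultimately show "((\<lambda>\<zeta>. \<integral>t. f t \<zeta> \<partial>M) has_field_derivative (\<integral>t. deriv (f t) \<zeta>0 \<partial>M)) (at \<zeta>0)"
    unfolding DERIV_def by (rule Lim_transform_eventually)
qed

text \<open>The substitution \<open>u = exp t\<close> carries Euler's integral to the whole line,
  where shifts of \<open>t\<close> replace rescalings of \<open>u\<close>; the Jacobian turns the
  exponent \<open>b - 1\<close> into \<open>b\<close>.\<close>

lemma integral_exp_exp:
  fixes q b :: real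
  assumes "q > 0" "b > 0"
  shows "integrable lborel (\<lambda>t. exp (- q * exp t) * exp (b * t))"
    and "(\<integral>t. exp (- exp t) * exp (b * t) \<partial>lborel) = Gamma b"
proof -
  have img: "exp ` UNIV = {0::real<..}" by auto (metis exp_ln rangeI)
  have inj: "inj_on exp (UNIV :: real set)" by (simp add: inj_on_def)
  have eq: "(\<lambda>t. \<bar>exp t\<bar> *\<^sub>R (exp t powr (b - 1) / exp (q * exp t))) =
        (\<lambda>t. exp (- q * exp t) * exp (b * t))" for q
    by (auto simp: powr_def exp_minus algebra_simps exp_diff field_simps simp flip: exp_add)
  have ai: "(\<lambda>t::real. t powr (b - 1) / exp (q * t)) absolutely_integrable_on {0<..}" if "q > 0" for q
  proof -
    have "(\<lambda>t. norm (complex_of_real t powr (of_real b - 1) / of_real (exp (q * t))))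
        absolutely_integrable_on {0<..}"
      using absolutely_integrable_Gamma_integral[of "of_real b" q] assms that
      by (intro absolutely_integrable_norm[unfolded o_def]) simp
    then show ?thesis
      by (rule absolutely_integrable_spike[OF _ negligible_empty])
         (auto simp: norm_divide norm_powr_real_powr)
  qed
  have i: "(\<lambda>t. exp (- q * exp t) * exp (b * t)) absolutely_integrable_on UNIV" if "q > 0" for q
    using absolutely_integrable_change_of_variables_real[OF _ _ inj,
        of exp "\<lambda>t. t powr (b - 1) / exp (q * t)"] ai[OF that] eq[of q]
    unfolding img by (auto intro!: derivative_eq_intros)
  have l: "integrable lborel (\<lambda>t. exp (- q * exp t) * exp (b * t))" if "q > 0" for q
    using i[OF that] by (simp add: set_integrable_def integrable_completion)
  show "integrable lborel (\<lambda>t. exp (- q * exp t) * exp (b * t))" by (rule l) fact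
  have "((\<lambda>t. t powr (b - 1) / exp t) has_integral Gamma b) {0<..}"
    by (rule has_integral_spike_set_eq[THEN iffD1, OF _ _ Gamma_integral_real[OF assms(2)]])
       (auto intro: negligible_subset[of "{0}"])
  then have "integral {0<..} (\<lambda>t. t powr (b - 1) / exp (1 * t)) = Gamma b"
    by (simp add: integral_unique)
  then have "integral UNIV (\<lambda>t. exp (- 1 * exp t) * exp (b * t)) = Gamma b"
    using has_absolute_integral_change_of_variables_1'[OF _ _ inj,
        of exp "\<lambda>t. t powr (b - 1) / exp (1 * t)" "Gamma b"] ai[of 1] eq[of 1]
    unfolding img by (auto intro!: derivative_eq_intros)
  moreover have "(\<integral>t. exp (- 1 * exp t) * exp (b * t) \<partial>lborel) = integral UNIV (\<lambda>t. exp (- 1 * exp t) * exp (b * t))"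
    using integral_lborel[OF l[of 1]] by simp
  ultimately show "(\<integral>t. exp (- exp t) * exp (b * t) \<partial>lborel) = Gamma b" by simp
qed

section \<open>The rotated Laplace integrals\<close>

text \<open>
  With \<open>t = exp w\<close>, \<open>z = exp \<zeta>\<close>, the classical integrand \<open>exp (-t) t\<^bsup>a-1\<^esup> (1 + t/z)\<^bsup>-c\<^esup> dt\<close> on the
  horizontal line \<open>w = \<tau> + l \<zeta>\<close>. The slope \<open>l = 0\<close> serves the slit plane, \<open>l = 1/3\<close> the whole sector
  \<open>\<bar>Im \<zeta>\<bar> < 3\<pi>/2\<close>, and \<open>l = 1\<close> with \<open>c = 0\<close> gives the rotated Gamma integral.
\<close>
definition whit_kernel :: "complex \<Rightarrow> complex \<Rightarrow> real \<Rightarrow> real \<Rightarrow> complex \<Rightarrow> complex" where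
  "whit_kernel a c l t \<zeta> =
     exp (- exp (of_real t + of_real l * \<zeta>)) * exp (a * (of_real t + of_real l * \<zeta>)) *
     exp (- c * Ln (1 + exp (of_real t - of_real (1 - l) * \<zeta>)))"

definition whit_int :: "complex \<Rightarrow> complex \<Rightarrow> real \<Rightarrow> complex \<Rightarrow> complex" where
  "whit_int a c l \<zeta> = (\<integral>t. whit_kernel a c l t \<zeta> \<partial>lborel)"

text \<open>The first condition makes \<open>exp (-t)\<close> decay on the rotated ray, the second
  keeps \<open>1 + t/z\<close> off the branch cut of \<open>Ln\<close>.\<close>

definition whit_dom :: "real \<Rightarrow> complex set" where
  "whit_dom l = {\<zeta>. \<bar>l * Im \<zeta>\<bar> < pi / 2 \<and> \<bar>(1 - l) * Im \<zeta>\<bar> < pi}"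

section \<open>Bounds on the kernel and local domination\<close>

lemma exp_not_nonpos_Reals:
  assumes "\<bar>Im v\<bar> < pi"
  shows "exp v \<notin> \<real>\<^sub>\<le>\<^sub>0"
proof
  assume "exp v \<in> \<real>\<^sub>\<le>\<^sub>0"
  then have *: "Re (exp v) \<le> 0" "Im (exp v) = 0" by (auto simp: complex_nonpos_Reals_iff)
  then have "sin (Im v) = 0" by (simp add: Im_exp)
  then have "Im v = 0" using assms sin_eq_0_pi by (metis abs_less_iff minus_less_iff)
  then show False using *(1) by (simp add: Re_exp)
qed

lemma one_plus_exp_not_nonpos_Reals: "\<bar>Im v\<bar> < pi \<Longrightarrow> 1 + exp v \<notin> \<real>\<^sub>\<le>\<^sub>0"
  using exp_not_nonpos_Reals[of v] by (auto simp: complex_nonpos_Reals_iff)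

lemma one_plus_exp_nonzero: "\<bar>Im v\<bar> < pi \<Longrightarrow> 1 + exp v \<noteq> 0" for v :: complex
  using one_plus_exp_not_nonpos_Reals[of v] by auto

text \<open>With \<open>C = cos (Im v / 2)\<close> and \<open>e = exp (Re v)\<close>, the squared
  norm is the combination of (1 + e)^2 and (1 - e)^2 with weights C^2 and 1 - C^2; the second term
  is dropped. This keeps \<open>1 + t/z\<close> away from 0 uniformly on closed subsectors.\<close>

lemma norm_one_plus_exp_ge:
  assumes "\<bar>Im v\<bar> \<le> pi"
  shows "cos (Im v / 2) * (1 + exp (Re v)) \<le> norm (1 + exp v)"
proof (rule power2_le_imp_le)
  define e C where "e = exp (Re v)" and "C = cos (Im v / 2)"
  have cs: "cos (Im v) = 2 * C\<^sup>2 - 1" using cos_double_cos[of "Im v / 2"] by (simp add: C_def)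
  have "(norm (1 + exp v))\<^sup>2 = (1 + e * cos (Im v))\<^sup>2 + (e * sin (Im v))\<^sup>2"
    by (simp add: cmod_power2 Re_exp Im_exp e_def)
  also have "\<dots> = 1 + 2 * e * cos (Im v) + e\<^sup>2 * ((sin (Im v))\<^sup>2 + (cos (Im v))\<^sup>2)"
    by (simp only: power2_eq_square) algebra
  also have "\<dots> = (C * (1 + e))\<^sup>2 + (1 - C\<^sup>2) * (1 - e)\<^sup>2"
    unfolding sin_cos_squared_add unfolding cs by (simp add: power2_eq_square algebra_simps)
  finally have eq: "(norm (1 + exp v))\<^sup>2 = (C * (1 + e))\<^sup>2 + (1 - C\<^sup>2) * (1 - e)\<^sup>2" .
  have "C\<^sup>2 \<le> 1" by (simp add: C_def abs_square_le_1)
  then show "(cos (Im v / 2) * (1 + exp (Re v)))\<^sup>2 \<le> (norm (1 + exp v))\<^sup>2"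
    unfolding eq by (simp flip: C_def e_def)
qed simp

text \<open>The imaginary parts of \<open>a\<close> and \<open>c\<close> meet only arguments of
  modulus at most \<open>pi\<close>, whence the constant; since \<open>Re c \<ge> 0\<close>, the
  last factor needs only the lower bound \<open>cos (\<theta> / 2)\<close> for its base. The rest
  depends on \<open>\<zeta>\<close> through \<open>t + l * Re \<zeta>\<close> alone.\<close>

lemma norm_whit_kernel_le:
  assumes "0 \<le> Re a" "0 \<le> Re c" "\<phi> < pi / 2" "\<theta> < pi"
    and w: "\<bar>l * Im \<zeta>\<bar> \<le> \<phi>" and v: "\<bar>(1 - l) * Im \<zeta>\<bar> \<le> \<theta>"
  shows "norm (whit_kernel a c l t \<zeta>) \<le>
    exp ((\<bar>Im a\<bar> + \<bar>Im c\<bar>) * pi - Re c * ln (cos (\<theta> / 2))) *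
    (exp (- cos \<phi> * exp (t + l * Re \<zeta>)) * exp (Re a * (t + l * Re \<zeta>)))"
proof -
  define V where "V = of_real t - of_real (1 - l) * \<zeta>"
  have ImV: "Im V = - ((1 - l) * Im \<zeta>)" by (simp add: V_def)
  have ImV': "\<bar>Im V\<bar> \<le> \<theta>" "\<bar>Im V\<bar> < pi" using v assms unfolding ImV by auto
  have c1: "cos \<phi> \<le> cos (l * Im \<zeta>)"
    using cos_monotone_0_pi_le[of "\<bar>l * Im \<zeta>\<bar>" \<phi>] w assms(3) by simp
  have c2: "0 < cos (\<theta> / 2)" using v assms(4) by (intro cos_gt_zero_pi) auto
  have "cos (\<theta> / 2) \<le> cos (Im V / 2)"
    using cos_monotone_0_pi_le[of "\<bar>Im V / 2\<bar>" "\<theta> / 2"] ImV' assms(4) by (simp del: abs_divide)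
  also have "\<dots> \<le> cos (Im V / 2) * (1 + exp (Re V))"
    using cos_gt_zero_pi[of "Im V / 2"] ImV'(2) by (simp add: abs_less_iff)
  also have "\<dots> \<le> norm (1 + exp V)" using ImV' by (intro norm_one_plus_exp_ge) auto
  finally have "cos (\<theta> / 2) \<le> norm (1 + exp V)" .
  then have "ln (cos (\<theta> / 2)) \<le> Re (Ln (1 + exp V))"
    using c2 one_plus_exp_nonzero[OF ImV'(2)] by (simp add: Re_Ln)
  then have r1: "Re c * ln (cos (\<theta> / 2)) \<le> Re c * Re (Ln (1 + exp V))"
    by (rule mult_left_mono) fact
  have "\<bar>Im (Ln (1 + exp V))\<bar> \<le> pi"
    using one_plus_exp_nonzero[OF ImV'(2)] mpi_less_Im_Ln Im_Ln_le_pi by (simp add: abs_le_iff less_imp_le minus_le_iff)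
  then have "\<bar>Im c * Im (Ln (1 + exp V))\<bar> \<le> \<bar>Im c\<bar> * pi"
    unfolding abs_mult by (intro mult_left_mono) auto
  then have r2: "Im c * Im (Ln (1 + exp V)) \<le> \<bar>Im c\<bar> * pi" by linarith
  have "\<bar>Im a * (l * Im \<zeta>)\<bar> \<le> \<bar>Im a\<bar> * pi"
    unfolding abs_mult[of "Im a"] using w assms(3) pi_gt_zero by (intro mult_left_mono) linarith+
  then have r3: "- (Im a * (l * Im \<zeta>)) \<le> \<bar>Im a\<bar> * pi" by linarith
  have r4: "- (exp (t + l * Re \<zeta>) * cos (l * Im \<zeta>)) \<le> - cos \<phi> * exp (t + l * Re \<zeta>)"
    using c1 by (simp add: mult.commute mult_left_mono)
  have "norm (whit_kernel a c l t \<zeta>) =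
     exp (- (exp (t + l * Re \<zeta>) * cos (l * Im \<zeta>)) + (Re a * (t + l * Re \<zeta>) - Im a * (l * Im \<zeta>))
        + (- (Re c * Re (Ln (1 + exp V))) + Im c * Im (Ln (1 + exp V))))"
  proof -
    have "Re (- exp (of_real t + of_real l * \<zeta>)) = - (exp (t + l * Re \<zeta>) * cos (l * Im \<zeta>))"
      by (simp add: Re_exp)
    moreover have "Re (a * (of_real t + of_real l * \<zeta>)) = Re a * (t + l * Re \<zeta>) - Im a * (l * Im \<zeta>)"
      by simp
    moreover have "Re (- c * Ln (1 + exp V)) = - (Re c * Re (Ln (1 + exp V))) + Im c * Im (Ln (1 + exp V))"
      by simp
    ultimately show ?thesis
      unfolding whit_kernel_def V_def[symmetric] norm_mult norm_exp_eq_Re by (simp only: exp_add)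
  qed
  also have "\<dots> \<le> exp ((\<bar>Im a\<bar> + \<bar>Im c\<bar>) * pi - Re c * ln (cos (\<theta> / 2)) +
      (- cos \<phi> * exp (t + l * Re \<zeta>) + Re a * (t + l * Re \<zeta>)))"
    using r1 r2 r3 r4 unfolding exp_le_cancel_iff distrib_right by linarith
  finally show ?thesis by (simp only: exp_add)
qed

lemma continuous_on_whit_kernel:
  assumes "\<zeta> \<in> whit_dom l"
  shows "continuous_on UNIV (\<lambda>t. whit_kernel a c l t \<zeta>)"
proof -
  have "1 + exp (of_real t - of_real (1 - l) * \<zeta>) \<notin> \<real>\<^sub>\<le>\<^sub>0" for t
    using assms by (intro one_plus_exp_not_nonpos_Reals) (simp add: whit_dom_def)
  then show ?thesis unfolding whit_kernel_def by (intro continuous_intros) auto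
qed

lemma borel_measurable_whit_kernel:
  "\<zeta> \<in> whit_dom l \<Longrightarrow> (\<lambda>t. whit_kernel a c l t \<zeta>) \<in> borel_measurable borel"
  using continuous_on_whit_kernel borel_measurable_continuous_onI by blast

lemma whit_kernel_holomorphic:
  "(\<lambda>\<zeta>. whit_kernel a c l t \<zeta>) holomorphic_on whit_dom l"
proof -
  have "1 + exp (of_real t - of_real (1 - l) * \<zeta>) \<notin> \<real>\<^sub>\<le>\<^sub>0" if "\<zeta> \<in> whit_dom l" for \<zeta>
    using that by (intro one_plus_exp_not_nonpos_Reals) (simp add: whit_dom_def)
  then show ?thesis unfolding whit_kernel_def by (intro holomorphic_intros) auto
qed

lemma whit_int_locally_dominated:
  assumes "0 < Re a" "0 \<le> Re c" "0 \<le> l" "l \<le> 1" "\<zeta>0 \<in> whit_dom l"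
  obtains r g where "0 < r" "ball \<zeta>0 r \<subseteq> whit_dom l" "integrable lborel g"
    "\<And>t \<zeta>. \<zeta> \<in> ball \<zeta>0 r \<Longrightarrow> norm (whit_kernel a c l t \<zeta>) \<le> g t"
proof -
  \<comment> \<open>Taking at most half of each remaining gap leaves \<open>\<phi>\<close> and
    \<open>\<theta>\<close> strictly below \<open>pi / 2\<close> and \<open>pi\<close>; the cap 1
    lets \<open>l * Re \<zeta>\<close> vary by at most 1.\<close>
  define r where "r = min 1 (min ((pi/2 - \<bar>l * Im \<zeta>0\<bar>) / 2) ((pi - \<bar>(1 - l) * Im \<zeta>0\<bar>) / 2))"
  define \<phi> where "\<phi> = \<bar>l * Im \<zeta>0\<bar> + r"
  define \<theta> where "\<theta> = \<bar>(1 - l) * Im \<zeta>0\<bar> + r"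
  have r: "0 < r" "r \<le> 1" using assms(5) by (auto simp: r_def whit_dom_def)
  have "r \<le> (pi/2 - \<bar>l * Im \<zeta>0\<bar>) / 2" "r \<le> (pi - \<bar>(1 - l) * Im \<zeta>0\<bar>) / 2"
    unfolding r_def by linarith+
  moreover have "\<bar>l * Im \<zeta>0\<bar> < pi/2" "\<bar>(1 - l) * Im \<zeta>0\<bar> < pi"
    using assms(5) by (auto simp: whit_dom_def)
  moreover have "X + r < B" if "X < B" "r \<le> (B - X) / 2" for X B :: real
    using that by (simp add: field_simps)
  ultimately have pt: "\<phi> < pi/2" "\<theta> < pi" unfolding \<phi>_def \<theta>_def by blast+
  have near: "\<bar>l * Im \<zeta>\<bar> \<le> \<phi>" "\<bar>(1 - l) * Im \<zeta>\<bar> \<le> \<theta>" "\<bar>l * Re \<zeta> - l * Re \<zeta>0\<bar> \<le> 1"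
    if "\<zeta> \<in> ball \<zeta>0 r" for \<zeta>
  proof -
    have d: "norm (\<zeta> - \<zeta>0) < r" using that by (simp add: dist_norm norm_minus_commute)
    have "\<bar>Im \<zeta> - Im \<zeta>0\<bar> < r" "\<bar>Re \<zeta> - Re \<zeta>0\<bar> < r"
      using abs_Im_le_cmod[of "\<zeta> - \<zeta>0"] abs_Re_le_cmod[of "\<zeta> - \<zeta>0"] d by auto
    moreover have "\<bar>k * x - k * y\<bar> \<le> r" if "\<bar>x - y\<bar> < r" "0 \<le> k" "k \<le> 1" for k x y :: real
    proof -
      have "\<bar>k * x - k * y\<bar> = k * \<bar>x - y\<bar>" using that by (simp add: abs_mult flip: right_diff_distrib)
      also have "\<dots> \<le> 1 * r" using that by (intro mult_mono) auto
      finally show ?thesis by simp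
    qed
    ultimately have "\<bar>l * Im \<zeta> - l * Im \<zeta>0\<bar> \<le> r" "\<bar>(1-l) * Im \<zeta> - (1-l) * Im \<zeta>0\<bar> \<le> r"
      "\<bar>l * Re \<zeta> - l * Re \<zeta>0\<bar> \<le> r"
      using assms by auto
    then show "\<bar>l * Im \<zeta>\<bar> \<le> \<phi>" "\<bar>(1 - l) * Im \<zeta>\<bar> \<le> \<theta>" "\<bar>l * Re \<zeta> - l * Re \<zeta>0\<bar> \<le> 1"
      using r(2) unfolding \<phi>_def \<theta>_def by linarith+
  qed
  define C where "C = exp ((\<bar>Im a\<bar> + \<bar>Im c\<bar>) * pi - Re c * ln (cos (\<theta> / 2)))"
  \<comment> \<open>\<open>l * Re \<zeta>\<close> is replaced by its lower end (shift -1) in the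
    decaying factor and, as \<open>Re a > 0\<close>, by its upper end (shift +1) in the
    power.\<close>
  define q where "q = cos \<phi> * exp (l * Re \<zeta>0 - 1)"
  define g where "g = (\<lambda>t. C * exp (Re a * (l * Re \<zeta>0 + 1)) * (exp (- q * exp t) * exp (Re a * t)))"
  have "0 \<le> \<phi>" using r by (simp add: \<phi>_def)
  then have c0: "0 < cos \<phi>" using pt by (intro cos_gt_zero_pi) auto
  then have "q > 0" by (simp add: q_def)
  then have "integrable lborel g" unfolding g_def using integral_exp_exp(1)[of q "Re a"] assms by simp
  moreover have "norm (whit_kernel a c l t \<zeta>) \<le> g t" if "\<zeta> \<in> ball \<zeta>0 r" for t \<zeta>
  proof -
    have "norm (whit_kernel a c l t \<zeta>) \<le> C * (exp (- cos \<phi> * exp (t + l * Re \<zeta>)) * exp (Re a * (t + l * Re \<zeta>)))"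
      unfolding C_def using near[OF that] assms pt by (intro norm_whit_kernel_le) auto
    also have "\<dots> \<le> C * (exp (- q * exp t) * exp (Re a * (t + (l * Re \<zeta>0 + 1))))"
    proof (intro mult_left_mono mult_mono)
      have "cos \<phi> * exp (l * Re \<zeta>0 - 1 + t) \<le> cos \<phi> * exp (t + l * Re \<zeta>)"
        using c0 near(3)[OF that] by (intro mult_left_mono) auto
      then show "exp (- cos \<phi> * exp (t + l * Re \<zeta>)) \<le> exp (- q * exp t)"
        by (simp add: q_def exp_add mult.assoc)
      show "exp (Re a * (t + l * Re \<zeta>)) \<le> exp (Re a * (t + (l * Re \<zeta>0 + 1)))"
        using assms near(3)[OF that] by (auto intro!: mult_left_mono)
    qed (auto simp: C_def)
    also have "\<dots> = g t" by (simp add: g_def algebra_simps exp_add)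
    finally show ?thesis .
  qed
  moreover have "ball \<zeta>0 r \<subseteq> whit_dom l" unfolding whit_dom_def using near pt by fastforce
  ultimately show ?thesis using r(1) that by blast
qed

lemma
  assumes "0 < Re a" "0 \<le> Re c" "0 \<le> l" "l \<le> 1" "\<zeta> \<in> whit_dom l"
  shows integrable_whit_kernel: "integrable lborel (\<lambda>t. whit_kernel a c l t \<zeta>)"
    and has_field_derivative_whit_int:
      "(whit_int a c l has_field_derivative (\<integral>t. deriv (whit_kernel a c l t) \<zeta> \<partial>lborel)) (at \<zeta>)"
proof -
  obtain r g where rg: "0 < r" "ball \<zeta> r \<subseteq> whit_dom l" "integrable lborel g"
    "\<And>t \<xi>. \<xi> \<in> ball \<zeta> r \<Longrightarrow> norm (whit_kernel a c l t \<xi>) \<le> g t"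
    using whit_int_locally_dominated[OF assms] by metis
  have m: "(\<lambda>t. whit_kernel a c l t \<xi>) \<in> borel_measurable lborel" if "\<xi> \<in> ball \<zeta> r" for \<xi>
    using borel_measurable_whit_kernel[of \<xi> l a c] rg(2) that by auto
  show "integrable lborel (\<lambda>t. whit_kernel a c l t \<zeta>)"
  proof (rule Bochner_Integration.integrable_bound[OF rg(3) m])
    have "norm (whit_kernel a c l t \<zeta>) \<le> norm (g t)" for t
      using rg(1) rg(4)[of \<zeta> t] by auto
    then show "AE t in lborel. norm (whit_kernel a c l t \<zeta>) \<le> norm (g t)" by blast
  qed (use rg in auto)
  have "((\<lambda>\<zeta>. \<integral>t. whit_kernel a c l t \<zeta> \<partial>lborel) has_field_derivative
     (\<integral>t. deriv (whit_kernel a c l t) \<zeta> \<partial>lborel)) (at \<zeta>)"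
    by (rule has_field_derivative_parametric_integral[OF rg(1) m _ rg(4) rg(3)])
       (use rg(2) whit_kernel_holomorphic holomorphic_on_subset in blast)+
  then show "(whit_int a c l has_field_derivative (\<integral>t. deriv (whit_kernel a c l t) \<zeta> \<partial>lborel)) (at \<zeta>)"
    by (simp add: whit_int_def[abs_def])
qed

lemma whit_int_holomorphic:
  assumes "0 < Re a" "0 \<le> Re c" "0 \<le> l" "l \<le> 1"
  shows "whit_int a c l holomorphic_on whit_dom l"
  using has_field_derivative_whit_int[OF assms] has_field_derivative_at_within
  by (fastforce simp: holomorphic_on_def field_differentiable_def)

section \<open>Independence of the slope\<close>

lemma whit_int_of_real: "whit_int a c l (of_real x) = whit_int a c 0 (of_real x)"
proof -
  have "whit_kernel a c l t (of_real x) = whit_kernel a c 0 (l * x + 1 * t) (of_real x)" for t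
    by (simp add: whit_kernel_def algebra_simps)
  then show ?thesis
    unfolding whit_int_def
    by (subst (2) lborel_integral_real_affine[of 1 _ "l * x"]) simp_all
qed

lemma convex_Im_strip: "convex {\<zeta>. \<bar>Im \<zeta>\<bar> < B}"
proof -
  have "{\<zeta>. \<bar>Im \<zeta>\<bar> < B} = {\<zeta>. Im \<zeta> < B} \<inter> {\<zeta>. Im \<zeta> > - B}" by auto
  then show ?thesis by (simp add: convex_Int convex_halfspace_Im_lt convex_halfspace_Im_gt)
qed

lemma open_Im_strip: "open {\<zeta>. \<bar>Im \<zeta>\<bar> < B}"
  by (intro open_Collect_less continuous_intros)

text \<open>Rotating the line of integration: by translation invariance the integrals agree for real
  \<open>\<zeta>\<close>, and the identity theorem does the rest.\<close>
lemma whit_int_eq_on_strip: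
  assumes "0 < Re a" "0 \<le> Re c" "0 \<le> l" "l \<le> 1"
    and "{\<zeta>. \<bar>Im \<zeta>\<bar> < B} \<subseteq> whit_dom l" "{\<zeta>. \<bar>Im \<zeta>\<bar> < B} \<subseteq> whit_dom 0"
    and "\<bar>Im \<zeta>\<bar> < B"
  shows "whit_int a c l \<zeta> = whit_int a c 0 \<zeta>"
proof -
  let ?S = "{\<zeta>. \<bar>Im \<zeta>\<bar> < B}"
  have B: "B > 0" using assms(7) by linarith
  have "whit_int a c l \<zeta> - whit_int a c 0 \<zeta> = 0"
  proof (rule analytic_continuation[where f = "\<lambda>\<zeta>. whit_int a c l \<zeta> - whit_int a c 0 \<zeta>" and S = ?S and U = \<real> and \<xi> = 0])
    show "(\<lambda>\<zeta>. whit_int a c l \<zeta> - whit_int a c 0 \<zeta>) holomorphic_on ?S"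
      using assms by (intro holomorphic_intros holomorphic_on_subset[OF whit_int_holomorphic]) auto
    \<comment> \<open>A connected set with more than one point has no isolated points.\<close>
    show "(0::complex) islimpt \<real>"
      by (intro connected_imp_perfect convex_connected convex_Reals)
         (auto, metis Reals_0 Reals_1 singletonD zero_neq_one)
    show "whit_int a c l z - whit_int a c 0 z = 0" if "z \<in> \<real>" for z
      using that whit_int_of_real[of a c l] by (auto elim!: Reals_cases)
  qed (use assms B in \<open>auto simp: open_Im_strip convex_connected convex_Im_strip elim!: Reals_cases\<close>)
  then show ?thesis by simp
qed

section \<open>The Whittaker equation\<close>

lemma mem_whit_dom_0 [simp]: "\<zeta> \<in> whit_dom 0 \<longleftrightarrow> \<bar>Im \<zeta>\<bar> < pi"
  by (simp add: whit_dom_def)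

lemma mem_whit_dom_1 [simp]: "\<zeta> \<in> whit_dom 1 \<longleftrightarrow> \<bar>Im \<zeta>\<bar> < pi / 2"
  by (simp add: whit_dom_def)

text \<open>Slope 1/3 makes both conditions coincide: \<open>l\<close> is to \<open>1 - l\<close> as
  \<open>pi / 2\<close> is to \<open>pi\<close>, and either condition then gives the full
  sector.\<close>

lemma mem_whit_dom_third [simp]: "\<zeta> \<in> whit_dom (1/3) \<longleftrightarrow> \<bar>Im \<zeta>\<bar> < 3 * pi / 2"
  by (auto simp: whit_dom_def abs_mult)

lemma whit_kernel_plus_one:
  assumes "\<bar>Im \<zeta>\<bar> < pi"
  shows "whit_kernel a (c + 1) 0 t \<zeta> * (1 + exp (of_real t - \<zeta>)) = whit_kernel a c 0 t \<zeta>"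
proof -
  have nz: "1 + exp (of_real t - \<zeta>) \<noteq> 0" using assms by (intro one_plus_exp_nonzero) simp
  have "exp (- (c + 1) * Ln (1 + exp (of_real t - \<zeta>))) * (1 + exp (of_real t - \<zeta>)) =
      exp (- (c + 1) * Ln (1 + exp (of_real t - \<zeta>))) * exp (Ln (1 + exp (of_real t - \<zeta>)))"
    using nz by simp
  also have "\<dots> = exp (- c * Ln (1 + exp (of_real t - \<zeta>)))"
    unfolding exp_add[symmetric] by (simp add: algebra_simps)
  finally show ?thesis by (simp add: whit_kernel_def)
qed

text \<open>With \<open>e = exp (t - \<zeta>)\<close> the logarithmic derivative is
  \<open>c * e / (1 + e) = c * (1 - 1 / (1 + e))\<close>, and a factor \<open>1 / (1 + e)\<close>
  raises \<open>c\<close> by one. So derivatives stay in the same family of kernels.\<close>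

lemma deriv_whit_kernel:
  assumes "\<bar>Im \<zeta>\<bar> < pi"
  shows "deriv (whit_kernel a c 0 t) \<zeta> = c * (whit_kernel a c 0 t \<zeta> - whit_kernel a (c + 1) 0 t \<zeta>)"
proof (rule DERIV_imp_deriv)
  let ?e = "exp (of_real t - \<zeta>)"
  have np: "1 + ?e \<notin> \<real>\<^sub>\<le>\<^sub>0" using assms by (intro one_plus_exp_not_nonpos_Reals) simp
  then have nz: "1 + ?e \<noteq> 0" by auto
  have "(whit_kernel a c 0 t has_field_derivative whit_kernel a c 0 t \<zeta> * (c * (?e / (1 + ?e)))) (at \<zeta>)"
    unfolding whit_kernel_def[abs_def] using np
    by (auto intro!: derivative_eq_intros simp: field_simps)
  also have "whit_kernel a c 0 t \<zeta> * (c * (?e / (1 + ?e))) =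
      c * (whit_kernel a c 0 t \<zeta> - whit_kernel a (c + 1) 0 t \<zeta>)"
    unfolding whit_kernel_plus_one[OF assms, symmetric, of a c] using nz by (simp add: field_simps)
  finally show "(whit_kernel a c 0 t has_field_derivative
      c * (whit_kernel a c 0 t \<zeta> - whit_kernel a (c + 1) 0 t \<zeta>)) (at \<zeta>)" .
qed

lemma whit_int_deriv:
  assumes "0 < Re a" "0 \<le> Re c" "\<bar>Im \<zeta>\<bar> < pi"
  shows "(whit_int a c 0 has_field_derivative c * (whit_int a c 0 \<zeta> - whit_int a (c + 1) 0 \<zeta>)) (at \<zeta>)"
proof -
  have "(\<integral>t. deriv (whit_kernel a c 0 t) \<zeta> \<partial>lborel) = c * (whit_int a c 0 \<zeta> - whit_int a (c + 1) 0 \<zeta>)"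
    unfolding deriv_whit_kernel[OF assms(3)] whit_int_def
    using assms by (simp add: integrable_whit_kernel)
  then show ?thesis using has_field_derivative_whit_int[of a c 0 \<zeta>] assms by simp
qed

text \<open>The integral of the derivative in \<open>t\<close> of the kernel with parameter \<open>c + 1\<close> vanishes.\<close>
lemma whit_int_contiguous:
  assumes a: "0 < Re a" and c: "0 \<le> Re c" and \<zeta>: "\<bar>Im \<zeta>\<bar> < pi"
  shows "(exp \<zeta> + a - c - 1) * whit_int a (c + 1) 0 \<zeta> + (c + 1) * whit_int a (c + 2) 0 \<zeta>
    = exp \<zeta> * whit_int a c 0 \<zeta>"
proof -
  define K where "K = (\<lambda>j t. whit_kernel a (c + j) 0 t \<zeta>)"
  \<comment> \<open>The derivative of \<open>K 1\<close> is \<open>K 1\<close> times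
    \<open>- exp t + a - (c + 1) * e / (1 + e)\<close> with \<open>e = exp (t - \<zeta>)\<close>. It
    becomes \<open>D\<close> through \<open>K 0 = K 1 * (1 + e)\<close>,
    \<open>K 1 = K 2 * (1 + e)\<close> and \<open>exp t = exp \<zeta> * e\<close>.\<close>
  define D where "D = (\<lambda>t. (exp \<zeta> + a - c - 1) * K 1 t + (c + 1) * K 2 t - exp \<zeta> * K 0 t)"
  have iK: "integrable lborel (K j)" if "0 \<le> Re j" for j
    unfolding K_def using assms that by (intro integrable_whit_kernel) auto
  have iD: "integrable lborel D" unfolding D_def by (intro iK Bochner_Integration.integrable_add
      Bochner_Integration.integrable_diff integrable_mult_right) auto
  have cK: "continuous_on UNIV (K j)" for j
    unfolding K_def using \<zeta> by (intro continuous_on_whit_kernel) auto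
  have cD: "continuous_on UNIV D" unfolding D_def by (intro continuous_intros cK)
  have der: "(K 1 has_vector_derivative D t) (at t)" for t
  proof -
    let ?e = "exp (of_real t - \<zeta>)"
    let ?f = "\<lambda>w. exp (- exp w + a * w - (c + 1) * Ln (1 + exp (w - \<zeta>)))"
    have f: "?f (of_real x) = K 1 x" for x
      unfolding K_def whit_kernel_def exp_add[symmetric] by (simp add: algebra_simps)
    have np: "1 + ?e \<notin> \<real>\<^sub>\<le>\<^sub>0" using \<zeta> by (intro one_plus_exp_not_nonpos_Reals) simp
    then have nz: "1 + ?e \<noteq> 0" by auto
    have k0: "K 0 t = K 1 t * (1 + ?e)"
      using whit_kernel_plus_one[OF \<zeta>, of a c t] by (simp add: K_def)
    have k1: "K 1 t = K 2 t * (1 + ?e)"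
      using whit_kernel_plus_one[OF \<zeta>, of a "c + 1" t] by (simp add: K_def add.assoc)
    have ez: "exp (of_real t) = exp \<zeta> * ?e" by (simp flip: exp_add)
    have "(?f has_field_derivative K 1 t * (- exp (of_real t) + a - (c + 1) * (?e / (1 + ?e)))) (at (of_real t))"
      unfolding f[symmetric] using np by (auto intro!: derivative_eq_intros simp: divide_inverse mult_ac)
    also have "K 1 t * (- exp (of_real t) + a - (c + 1) * (?e / (1 + ?e))) = D t"
      unfolding D_def k0 ez unfolding k1 using nz by (simp add: field_simps)
    finally have "((\<lambda>x. ?f (of_real x)) has_vector_derivative D t) (at t)"
      by (rule has_vector_derivative_real_field)
    then show ?thesis unfolding f .
  qed
  define C where "C = exp ((\<bar>Im a\<bar> + \<bar>Im (c + 1)\<bar>) * pi - Re (c + 1) * ln (cos (\<bar>Im \<zeta>\<bar> / 2)))"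
  have bd: "norm (K 1 t) \<le> C * (exp (- exp t) * exp (Re a * t))" for t
    using norm_whit_kernel_le[of a "c + 1" 0 "\<bar>Im \<zeta>\<bar>" 0 \<zeta> t] a c \<zeta>
    by (simp add: K_def C_def)
  have "((\<lambda>t. C * (exp (- exp t) * exp (Re a * t))) \<longlongrightarrow> 0) at_top"
    using a by real_asymp
  then have top: "(K 1 \<longlongrightarrow> 0) at_top" by (rule Lim_null_comparison[rotated]) (simp add: bd)
  have "((\<lambda>t. C * (exp (- exp t) * exp (Re a * t))) \<longlongrightarrow> 0) at_bot"
    using a by real_asymp
  then have bot: "(K 1 \<longlongrightarrow> 0) at_bot" by (rule Lim_null_comparison[rotated]) (simp add: bd)
  \<comment> \<open>The boundary values vanish: at the upper end through
    \<open>exp (- exp t)\<close>, at the lower end through \<open>exp (Re a * t)\<close>.\<close>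
  have "(LBINT t=-\<infinity>..\<infinity>. D t) = 0 - 0"
  proof (rule interval_integral_FTC_integrable[where F = "K 1"])
    show "isCont D t" for t using cD by (simp add: continuous_on_eq_continuous_at)
  qed (use der iD top bot in \<open>auto simp: ereal_tendsto_simps set_integrable_def einterval_def\<close>)
  then have "(\<integral>t. D t \<partial>lborel) = 0"
    by (simp add: interval_lebesgue_integral_def set_lebesgue_integral_def einterval_def)
  moreover have "(\<integral>t. D t \<partial>lborel) = (exp \<zeta> + a - c - 1) * whit_int a (c + 1) 0 \<zeta>
      + (c + 1) * whit_int a (c + 2) 0 \<zeta> - exp \<zeta> * whit_int a c 0 \<zeta>"
    unfolding D_def using iK[of 0] iK[of 1] iK[of 2] by (simp add: whit_int_def K_def)
  ultimately show ?thesis by simp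
qed

section \<open>Kummer's equation and the candidate for the Whittaker function\<close>

lemma exp_neg_plus_one_mult_Ln:
  assumes "z \<noteq> 0"
  shows "exp (- (c + 1) * Ln z) = exp (- c * Ln z) / z"
proof -
  have "- (c + 1) * Ln z = - c * Ln z - Ln z" by (simp add: algebra_simps)
  then show ?thesis by (simp only: exp_diff exp_Ln[OF assms])
qed

text \<open>This is Gamma(a) U(c, 1 + c - a, z) with Tricomi's function U. Absorbing z^(-c) turns
  the power in the integrand into (t + z)^(-c), so differentiation merely raises
  \<open>c\<close>.\<close>

definition whit_v :: "complex \<Rightarrow> complex \<Rightarrow> complex \<Rightarrow> complex" where
  "whit_v a c z = exp (- c * Ln z) * whit_int a c 0 (Ln z)"

lemma abs_Im_Ln_less_pi: "z \<notin> \<real>\<^sub>\<le>\<^sub>0 \<Longrightarrow> \<bar>Im (Ln z)\<bar> < pi"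
  using mpi_less_Im_Ln[of z] Im_Ln_less_pi[of z] by (cases "z = 0") (auto simp: abs_less_iff)

lemma has_field_derivative_whit_v [derivative_intros]:
  assumes "0 < Re a" "0 \<le> Re c" and z: "z \<notin> \<real>\<^sub>\<le>\<^sub>0"
  shows "(whit_v a c has_field_derivative - c * whit_v a (c + 1) z) (at z)"
proof -
  have [simp]: "z \<noteq> 0" using z by auto
  have d: "((\<lambda>z. whit_int a c 0 (Ln z)) has_field_derivative
      c * (whit_int a c 0 (Ln z) - whit_int a (c + 1) 0 (Ln z)) * (1 / z)) (at z)"
    by (rule DERIV_chain2[OF whit_int_deriv]) (use assms abs_Im_Ln_less_pi in \<open>auto intro!: derivative_eq_intros simp: field_simps\<close>)
  have e: "exp (- (c + 1) * Ln z) = exp (- c * Ln z) / z"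
    by (rule exp_neg_plus_one_mult_Ln) simp
  show ?thesis unfolding whit_v_def[abs_def] e
    by (rule derivative_eq_intros d refl z)+ (simp add: field_simps)
qed

text \<open>Writing v' and v'' by raising \<open>c\<close> and multiplying by \<open>c\<close> turns
  this into Kummer's equation z v'' + (1 + c - a - z) v' - c v = 0.\<close>

lemma whit_v_contiguous:
  assumes "0 < Re a" "0 \<le> Re c" and z: "z \<notin> \<real>\<^sub>\<le>\<^sub>0"
  shows "(z + a - c - 1) * whit_v a (c + 1) z + (c + 1) * z * whit_v a (c + 2) z = whit_v a c z"
proof -
  have [simp]: "z \<noteq> 0" using z by auto
  have e1: "exp (- (c + 1) * Ln z) = exp (- c * Ln z) / z"
    by (rule exp_neg_plus_one_mult_Ln) simp
  have e2: "exp (- (c + 2) * Ln z) = exp (- c * Ln z) / z / z"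
    using exp_neg_plus_one_mult_Ln[of z "c + 1"] unfolding e1 by (simp add: add.assoc)
  have "(z + a - c - 1) * whit_int a (c + 1) 0 (Ln z) + (c + 1) * whit_int a (c + 2) 0 (Ln z)
    = z * whit_int a c 0 (Ln z)"
    using whit_int_contiguous[of a c "Ln z"] assms abs_Im_Ln_less_pi by simp
  moreover have "(z + a - c - 1) * (e / z * I1) + (c + 1) * z * (e / z / z * I2) = e / z * ((z + a - c - 1) * I1 + (c + 1) * I2)"
    for e I1 I2 :: complex by (simp add: field_simps)
  ultimately show ?thesis unfolding whit_v_def e1 e2 by simp
qed

text \<open>This is \<open>\<Gamma>(a)\<close>; only its value at \<open>a = 3/4\<close> will be needed, and its continuity there.\<close>
definition whit_norm :: "complex \<Rightarrow> complex" where
  "whit_norm a = whit_int a 0 0 0"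

text \<open>Whittaker's function is even in \<open>\<mu>\<close>; the prefactor z^(1/4) belongs to
  the representation with -1/4, in which the remaining factor stays finite at 0. Division by
  \<open>whit_norm\<close> makes the leading coefficient at infinity 1.\<close>

definition whit_W :: "complex \<Rightarrow> complex \<Rightarrow> complex" where
  "whit_W \<kappa> z = exp (- z / 2) * exp (Ln z / 4) * whit_v (3/4 - \<kappa>) (1/4 - \<kappa>) z / whit_norm (3/4 - \<kappa>)"

lemma has_field_derivative_whit_W:
  assumes "Re \<kappa> \<le> 1/4" and z: "z \<notin> \<real>\<^sub>\<le>\<^sub>0"
  shows "(whit_W \<kappa> has_field_derivative
    exp (- z / 2) * exp (Ln z / 4) / whit_norm (3/4 - \<kappa>) *
    ((- 1/2 + 1 / (4 * z)) * whit_v (3/4 - \<kappa>) (1/4 - \<kappa>) z - (1/4 - \<kappa>) * whit_v (3/4 - \<kappa>) (1/4 - \<kappa> + 1) z)) (at z)"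
proof -
  have [simp]: "z \<noteq> 0" using z by auto
  \<comment> \<open>If \<open>whit_norm (3/4 - \<kappa>) = 0\<close>, the function and the claimed
    derivative are both 0, because \<open>x / 0 = 0\<close>.\<close>
  show ?thesis unfolding whit_W_def[abs_def] using assms
    by (cases "whit_norm (3/4 - \<kappa>) = 0") (auto intro!: derivative_eq_intros simp: field_simps)
qed

text \<open>For the prefactor E one has E'/E = P = -1/2 + 1/(4z). The potential cancels P^2 + P' up
  to -c/z, and what is left is Kummer's equation in its contiguous form.\<close>

lemma whit_W_ode:
  assumes "Re \<kappa> \<le> 1/4" and z: "z \<notin> \<real>\<^sub>\<le>\<^sub>0"
  shows "deriv (deriv (whit_W \<kappa>)) z + (- 1 / 4 + \<kappa> / z + (1 / 4 - (1/4)\<^sup>2) / z\<^sup>2) * whit_W \<kappa> z = 0"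
proof -
  define a c G where "a = 3/4 - \<kappa>" and "c = 1/4 - \<kappa>" and "G = whit_norm (3/4 - \<kappa>)"
  have ac: "0 < Re a" "0 \<le> Re c" "0 \<le> Re (c + 1)" using assms by (auto simp: a_def c_def)
  have z0 [simp]: "z \<noteq> 0" using z by auto
  let ?E = "\<lambda>z. exp (- z / 2) * exp (Ln z / 4) / G"
  define W1 where "W1 = (\<lambda>z. ?E z * ((- 1/2 + 1 / (4 * z)) * whit_v a c z - c * whit_v a (c + 1) z))"
  have "deriv (whit_W \<kappa>) u = W1 u" if "u \<in> - \<real>\<^sub>\<le>\<^sub>0" for u
    unfolding W1_def a_def c_def G_def
    by (rule DERIV_imp_deriv[OF has_field_derivative_whit_W]) (use assms that in auto)
  then have "deriv (deriv (whit_W \<kappa>)) z = deriv W1 z"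
    using z by (intro deriv_cong_ev eventually_nhds_in_open[THEN eventually_mono, of "- \<real>\<^sub>\<le>\<^sub>0"]) auto
  also have "\<dots> = ?E z * (((- 1/2 + 1 / (4 * z))\<^sup>2 - 1 / (4 * z\<^sup>2)) * whit_v a c z
      - 2 * c * (- 1/2 + 1 / (4 * z)) * whit_v a (c + 1) z + c * (c + 1) * whit_v a (c + 2) z)"
  proof (rule DERIV_imp_deriv)
    have dE: "(?E has_field_derivative ?E z * (- 1/2 + 1 / (4 * z))) (at z)"
      using z by (cases "G = 0") (auto intro!: derivative_eq_intros simp: field_simps)
    have dp: "((\<lambda>z. - 1/2 + 1 / (4 * z)) has_field_derivative - (1 / (4 * z\<^sup>2))) (at z)"
      by (auto intro!: derivative_eq_intros simp: power2_eq_square)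
    have dv: "(whit_v a c has_field_derivative - c * whit_v a (c + 1) z) (at z)"
      using ac z by (intro derivative_intros)
    have dv': "(whit_v a (c + 1) has_field_derivative - (c + 1) * whit_v a (c + 2) z) (at z)"
      using has_field_derivative_whit_v[of a "c + 1" z] ac z by (simp add: add.assoc)
    have alg: "E * P * (P * v - c * v1) + ((- Q * v + (- c * v1) * P) - c * (- (c + 1) * v2)) * E =
        E * ((P\<^sup>2 - Q) * v - 2 * c * P * v1 + c * (c + 1) * v2)" for E P Q v v1 v2 :: complex
      by (simp add: power2_eq_square algebra_simps)
    show "(W1 has_field_derivative ?E z * (((- 1/2 + 1 / (4 * z))\<^sup>2 - 1 / (4 * z\<^sup>2)) * whit_v a c z
      - 2 * c * (- 1/2 + 1 / (4 * z)) * whit_v a (c + 1) z + c * (c + 1) * whit_v a (c + 2) z)) (at z)"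
      unfolding W1_def
      by (rule DERIV_cong[OF DERIV_mult[OF dE DERIV_diff[OF DERIV_mult[OF dp dv] DERIV_cmult[OF dv']]]])
         (rule alg)
  qed
  finally have d2: "deriv (deriv (whit_W \<kappa>)) z = ?E z * (((- 1/2 + 1 / (4 * z))\<^sup>2 - 1 / (4 * z\<^sup>2)) * whit_v a c z
      - 2 * c * (- 1/2 + 1 / (4 * z)) * whit_v a (c + 1) z + c * (c + 1) * whit_v a (c + 2) z)" .
  have W: "whit_W \<kappa> z = ?E z * whit_v a c z" by (simp add: whit_W_def a_def c_def G_def)
  have v: "whit_v a c z = (z - 1/2) * whit_v a (c + 1) z + (c + 1) * z * whit_v a (c + 2) z"
    using whit_v_contiguous[of a c z] ac z by (simp add: a_def c_def algebra_simps)
  have k: "\<kappa> = 1/4 - c" by (simp add: c_def)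
  have "((- 1/2 + 1 / (4 * z))\<^sup>2 - 1 / (4 * z\<^sup>2) + (- 1 / 4 + \<kappa> / z + (1 / 4 - (1/4)\<^sup>2) / z\<^sup>2)) = - c / z"
    unfolding k by (simp add: field_simps power2_eq_square)
  then have "deriv (deriv (whit_W \<kappa>)) z + (- 1 / 4 + \<kappa> / z + (1 / 4 - (1/4)\<^sup>2) / z\<^sup>2) * whit_W \<kappa> z =
    ?E z * (- c / z * whit_v a c z - 2 * c * (- 1/2 + 1 / (4 * z)) * whit_v a (c + 1) z + c * (c + 1) * whit_v a (c + 2) z)"
    unfolding d2 W by (simp only: distrib_left[symmetric] mult.left_commute[of _ "?E z"]) (metis (no_types, lifting) add.commute add.left_commute add_diff_eq distrib_right diff_add_eq)
  also have "\<dots> = 0" unfolding v by (simp add: field_simps)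
  finally show ?thesis .
qed

section \<open>Existence and uniqueness of the Whittaker function\<close>

text \<open>Shifting \<open>t\<close> by \<open>l * Re \<zeta>\<close> frees the Gamma-type factor
  from the modulus of z: it sees only the angle \<open>l * Im \<zeta>\<close>, and z otherwise
  enters only through \<open>1 + t/z\<close>, which tends to 1 at infinity.\<close>

lemma whit_int_rotate:
  "whit_int a c l \<zeta> = (\<integral>t. whit_kernel a 0 1 t (\<i> * of_real (l * Im \<zeta>)) *
     exp (- c * Ln (1 + exp (of_real t + \<i> * of_real (l * Im \<zeta>) - \<zeta>))) \<partial>lborel)"
proof -
  have l: "of_real l * \<zeta> = of_real (l * Re \<zeta>) + \<i> * of_real (l * Im \<zeta>)"
    by (simp add: complex_eq_iff)
  have e1: "of_real (- (l * Re \<zeta>) + 1 * t) + of_real l * \<zeta> = of_real t + \<i> * of_real (l * Im \<zeta>)"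
    and e2: "of_real (- (l * Re \<zeta>) + 1 * t) - of_real (1 - l) * \<zeta> = of_real t + \<i> * of_real (l * Im \<zeta>) - \<zeta>" for t
    using l by (simp_all add: algebra_simps)
  have "whit_kernel a c l (- (l * Re \<zeta>) + 1 * t) \<zeta> = whit_kernel a 0 1 t (\<i> * of_real (l * Im \<zeta>)) *
     exp (- c * Ln (1 + exp (of_real t + \<i> * of_real (l * Im \<zeta>) - \<zeta>)))" for t
    unfolding whit_kernel_def e1 e2 by simp
  then show ?thesis
    unfolding whit_int_def
    by (subst lborel_integral_real_affine[of 1 _ "- (l * Re \<zeta>)"]) simp_all
qed

lemma whit_norm_rotate:
  assumes "0 < Re a" "\<bar>\<phi>\<bar> < pi / 2"
  shows "(\<integral>t. whit_kernel a 0 1 t (\<i> * of_real \<phi>) \<partial>lborel) = whit_norm a"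
proof -
  have "whit_int a 0 1 (\<i> * of_real \<phi>) = whit_int a 0 0 (\<i> * of_real \<phi>)"
    by (rule whit_int_eq_on_strip[where B = "pi / 2"]) (use assms in auto)
  also have "\<dots> = whit_norm a" by (simp add: whit_norm_def whit_int_def whit_kernel_def)
  finally show ?thesis by (simp add: whit_int_def)
qed

text \<open>The angle \<open>\<phi> n\<close> varies along the sequence, so the integrands
  \<open>J n\<close> need not converge. They are compared with \<open>K n\<close>, whose integral is
  \<open>whit_norm a\<close> at every angle; only \<open>J n - K n\<close> has to tend to 0, under a
  common majorant.\<close>

lemma whit_int_tendsto_sequentially:
  assumes a: "0 < Re a" and c: "0 \<le> Re c" and "\<delta> > 0"
    and X: "\<And>n. \<bar>Im (X n)\<bar> \<le> 3 * pi / 2 - \<delta>" "filterlim (\<lambda>n. Re (X n)) at_top sequentially"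
  shows "(\<lambda>n. whit_int a c (1/3) (X n)) \<longlonglongrightarrow> whit_norm a"
proof -
  define \<phi> where "\<phi> n = 1/3 * Im (X n)" for n
  \<comment> \<open>One third of the bound on \<open>Im\<close>; the other two thirds give
    \<open>pi - 2 * \<delta> / 3\<close> for the argument of t/z.\<close>
  define \<phi>0 where "\<phi>0 = pi / 2 - \<delta> / 3"
  have \<phi>: "\<bar>\<phi> n\<bar> \<le> \<phi>0" for n using X(1)[of n] by (simp add: \<phi>_def \<phi>0_def abs_le_iff)
  have \<phi>0: "0 \<le> \<phi>0" "\<phi>0 < pi / 2" using \<phi>[of 0] \<open>\<delta> > 0\<close> by (auto simp: \<phi>0_def)
  have cos0: "0 < cos \<phi>0" using \<phi>0 by (intro cos_gt_zero_pi) auto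
  have v: "\<bar>2/3 * Im (X n)\<bar> \<le> pi - 2 * \<delta> / 3" for n
    using X(1)[of n] by (simp add: abs_le_iff)
  define K where "K = (\<lambda>n t. whit_kernel a 0 1 t (\<i> * of_real (\<phi> n)))"
  define J where "J = (\<lambda>n t. K n t * exp (- c * Ln (1 + exp (of_real t + \<i> * of_real (\<phi> n) - X n))))"
  define g where "g = (\<lambda>t. exp (- cos \<phi>0 * exp t) * exp (Re a * t))"
  define C1 where "C1 = exp ((\<bar>Im a\<bar> + \<bar>Im (0::complex)\<bar>) * pi - Re 0 * ln (cos (0 / 2)))"
  define C2 where "C2 = exp ((\<bar>Im a\<bar> + \<bar>Im c\<bar>) * pi - Re c * ln (cos ((pi - 2 * \<delta> / 3) / 2)))"
  have gi: "integrable lborel g" unfolding g_def by (rule integral_exp_exp(1)) fact+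
  have Kb: "norm (K n t) \<le> C1 * g t" for n t
    using norm_whit_kernel_le[of a 0 \<phi>0 0 1 "\<i> * of_real (\<phi> n)" t] a \<phi>0 \<phi>[of n]
    by (simp add: K_def C1_def g_def)
  \<comment> \<open>Shifting back exhibits \<open>J n\<close> as the slope 1/3 kernel at
    \<open>X n\<close>; the shift cancels \<open>1/3 * Re (X n)\<close> in the kernel bound, so the
    majorant does not depend on \<open>n\<close>.\<close>
  have JK: "J n t = whit_kernel a c (1/3) (t - 1/3 * Re (X n)) (X n)" for n t
  proof -
    have "of_real (1/3) * X n = of_real (1/3 * Re (X n)) + \<i> * of_real (\<phi> n)"
      by (simp add: complex_eq_iff \<phi>_def)
    then have e: "of_real (t - 1/3 * Re (X n)) + of_real (1/3) * X n = of_real t + \<i> * of_real (\<phi> n)"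
      "of_real (t - 1/3 * Re (X n)) - of_real (1 - 1/3) * X n = of_real t + \<i> * of_real (\<phi> n) - X n"
      by (simp_all add: algebra_simps)
    show ?thesis unfolding J_def K_def whit_kernel_def e by simp
  qed
  have Jb: "norm (J n t) \<le> C2 * g t" for n t
    unfolding JK
    using norm_whit_kernel_le[of a c \<phi>0 "pi - 2 * \<delta> / 3" "1/3" "X n" "t - 1/3 * Re (X n)"] a c \<phi>0 \<phi>[of n] v[of n] \<open>\<delta> > 0\<close>
    by (simp add: C2_def g_def \<phi>_def)
  have dK: "\<i> * of_real (\<phi> n) \<in> whit_dom 1" for n using \<phi>[of n] \<phi>0 by simp
  have dX: "X n \<in> whit_dom (1/3)" for n using X(1)[of n] \<open>\<delta> > 0\<close> unfolding mem_whit_dom_third by linarith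
  have Km: "K n \<in> borel_measurable lborel" for n
    using borel_measurable_whit_kernel[OF dK] by (simp add: K_def)
  have Ki: "integrable lborel (K n)" for n
    unfolding K_def by (rule integrable_whit_kernel) (use a dK in auto)
  have "continuous_on UNIV (J n)" for n
    unfolding JK[abs_def] using continuous_on_whit_kernel[OF dX, of a c n]
    by (rule continuous_on_compose2) (auto intro!: continuous_intros)
  then have Jm: "J n \<in> borel_measurable lborel" for n
    using borel_measurable_continuous_onI by auto
  have Ji: "integrable lborel (J n)" for n
    by (rule Bochner_Integration.integrable_bound[OF integrable_mult_right[OF gi, of C2] Jm])
       (intro AE_I2, rule order_trans[OF Jb], simp)
  have "(\<lambda>n. \<integral>t. J n t - K n t \<partial>lborel) \<longlonglongrightarrow> (\<integral>t. (0::complex) \<partial>(lborel::real measure))"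
  proof (rule integral_dominated_convergence)
    show "integrable lborel (\<lambda>t. C2 * g t + C1 * g t)" using gi by simp
    show "AE t in lborel. norm (J n t - K n t) \<le> C2 * g t + C1 * g t" for n
      using Jb Kb by (intro AE_I2 order_trans[OF norm_triangle_ineq4] add_mono) auto
    show "AE t in lborel. (\<lambda>n. J n t - K n t) \<longlonglongrightarrow> 0"
    proof (intro AE_I2)
      fix t
      have "(\<lambda>n. exp (t - Re (X n))) \<longlonglongrightarrow> 0"
      proof -
        have "(\<lambda>n. exp t * exp (- Re (X n))) \<longlonglongrightarrow> 0"
          using X(2) by (intro tendsto_mult_right_zero filterlim_compose[OF exp_at_bot])
            (simp add: filterlim_uminus_at_bot)
        then show ?thesis by (simp add: exp_diff exp_minus divide_inverse)
      qed
      then have "(\<lambda>n. exp (of_real t + \<i> * of_real (\<phi> n) - X n)) \<longlonglongrightarrow> 0"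
        by (rule Lim_null_comparison[rotated]) simp
      then have "(\<lambda>n. exp (- c * Ln (1 + exp (of_real t + \<i> * of_real (\<phi> n) - X n))) - 1) \<longlonglongrightarrow> exp (- c * Ln (1 + 0)) - 1"
        by (intro tendsto_intros) auto
      then have "(\<lambda>n. C1 * g t * norm (exp (- c * Ln (1 + exp (of_real t + \<i> * of_real (\<phi> n) - X n))) - 1)) \<longlonglongrightarrow> 0"
        by (intro tendsto_mult_right_zero tendsto_norm_zero) simp
      then show "(\<lambda>n. J n t - K n t) \<longlonglongrightarrow> 0"
      proof (rule Lim_null_comparison[rotated], intro always_eventually allI)
        fix n
        have "J n t - K n t = K n t * (exp (- c * Ln (1 + exp (of_real t + \<i> * of_real (\<phi> n) - X n))) - 1)"
          by (simp add: J_def algebra_simps)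
        then show "norm (J n t - K n t) \<le> C1 * g t * norm (exp (- c * Ln (1 + exp (of_real t + \<i> * of_real (\<phi> n) - X n))) - 1)"
          using Kb[of n t] by (simp add: norm_mult mult_right_mono)
      qed
    qed
  qed (use Jm Km in auto)
  moreover have "(\<integral>t. J n t - K n t \<partial>lborel) = whit_int a c (1/3) (X n) - whit_norm a" for n
  proof -
    have "(\<integral>t. J n t \<partial>lborel) = whit_int a c (1/3) (X n)"
      unfolding whit_int_rotate[of a c "1/3"] by (simp add: J_def K_def \<phi>_def)
    moreover have "(\<integral>t. K n t \<partial>lborel) = whit_norm a"
      unfolding K_def by (rule whit_norm_rotate) (use a \<phi>[of n] \<phi>0 in auto)
    ultimately show ?thesis using Ji Ki by simp
  qed
  ultimately show ?thesis by (simp add: LIM_zero_iff)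
qed

text \<open>The filter has the countable base \<open>r x \<ge> real n\<close> within
  \<open>S\<close>, so sequences detect the limit; this matches dominated convergence, which is
  applied along sequences.\<close>

lemma tendsto_filtercomap_at_top_principal:
  fixes r :: "'a \<Rightarrow> real" and f :: "'a \<Rightarrow> 'b :: topological_space"
  assumes "\<And>X. (\<And>n. X n \<in> S) \<Longrightarrow> filterlim (\<lambda>n. r (X n)) at_top sequentially \<Longrightarrow> (\<lambda>n. f (X n)) \<longlonglongrightarrow> l"
  shows "(f \<longlongrightarrow> l) (inf (filtercomap r at_top) (principal S))"
proof (rule topological_tendstoI, rule ccontr)
  fix U assume U: "open U" "l \<in> U"
    and "\<not> (\<forall>\<^sub>F x in inf (filtercomap r at_top) (principal S). f x \<in> U)"
  then have "\<forall>n. \<exists>x. r x \<ge> real n \<and> x \<in> S \<and> f x \<notin> U"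
    unfolding eventually_inf_principal eventually_filtercomap_at_top_linorder by blast
  then obtain X where X: "\<And>n. r (X n) \<ge> real n" "\<And>n. X n \<in> S" "\<And>n. f (X n) \<notin> U"
    by meson
  have "filterlim (\<lambda>n. r (X n)) at_top sequentially"
    by (rule filterlim_at_top_mono[OF filterlim_real_sequentially]) (use X in auto)
  then have "(\<lambda>n. f (X n)) \<longlonglongrightarrow> l" using assms X(2) by blast
  from topological_tendstoD[OF this U] X(3) show False by simp
qed

lemma is_whittaker_W_whit_W:
  assumes \<kappa>: "Re \<kappa> \<le> 1/4" and G: "whit_norm (3/4 - \<kappa>) \<noteq> 0"
  shows "is_whittaker_W \<kappa> (1/4) (whit_W \<kappa>)"
proof -
  define a c where "a = 3/4 - \<kappa>" and "c = 1/4 - \<kappa>"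
  have ac: "0 < Re a" "0 \<le> Re c" using \<kappa> by (auto simp: a_def c_def)
  \<comment> \<open>The slope 1/3 integral lives on the whole sector and agrees with slope 0 on the
    strip of width \<open>2 * pi\<close>; the exponent \<open>\<kappa>\<close> is 1/4 from the
    prefactor plus \<open>- c\<close> from \<open>whit_v\<close>.\<close>
  define F where "F = (\<lambda>\<zeta>. exp (- exp \<zeta> / 2) * exp (\<kappa> * \<zeta>) * whit_int a c (1/3) \<zeta> / whit_norm a)"
  show ?thesis unfolding is_whittaker_W_def
  proof (intro conjI exI[of _ F] allI impI)
    show "whit_W \<kappa> holomorphic_on - \<real>\<^sub>\<le>\<^sub>0"
      unfolding holomorphic_on_open[OF open_Compl[OF closed_nonpos_Reals_complex]]
      using has_field_derivative_whit_W[OF \<kappa>] by blast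
    show "deriv (deriv (whit_W \<kappa>)) z + (- 1 / 4 + \<kappa> / z + (1 / 4 - (1 / 4)\<^sup>2) / z\<^sup>2) * whit_W \<kappa> z = 0"
      if "z \<notin> \<real>\<^sub>\<le>\<^sub>0" for z using whit_W_ode[OF \<kappa> that] .
    have "whit_dom (1/3) = {\<zeta>. \<bar>Im \<zeta>\<bar> < 3 * pi / 2}" by auto
    then show "F holomorphic_on {\<zeta>. \<bar>Im \<zeta>\<bar> < 3 * pi / 2}"
      using whit_int_holomorphic[of a c "1/3"] ac G unfolding F_def
      by (auto intro!: holomorphic_intros simp: a_def)
    show "F \<zeta> = whit_W \<kappa> (exp \<zeta>)" if "\<bar>Im \<zeta>\<bar> < pi" for \<zeta>
    proof -
      have L: "Ln (exp \<zeta>) = \<zeta>" using that by (intro Ln_exp) auto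
      have "whit_int a c (1/3) \<zeta> = whit_int a c 0 \<zeta>"
        by (rule whit_int_eq_on_strip[where B = pi]) (use ac that in auto)
      moreover have "exp (\<kappa> * \<zeta>) = exp (\<zeta> / 4) * exp (- c * \<zeta>)"
        by (simp add: c_def algebra_simps flip: exp_add)
      ultimately show ?thesis
        by (simp add: F_def whit_W_def whit_v_def L flip: a_def c_def)
    qed
    show "((\<lambda>\<zeta>. F \<zeta> / (exp (- exp \<zeta> / 2) * exp (\<kappa> * \<zeta>))) \<longlongrightarrow> 1)
       (inf (filtercomap Re at_top) (principal {\<zeta>. \<bar>Im \<zeta>\<bar> \<le> 3 * pi / 2 - \<delta>}))" if "\<delta> > 0" for \<delta>
    proof (rule tendsto_filtercomap_at_top_principal)
      fix X assume X: "\<And>n. X n \<in> {\<zeta>. \<bar>Im \<zeta>\<bar> \<le> 3 * pi / 2 - \<delta>}" "filterlim (\<lambda>n. Re (X n)) at_top sequentially"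
      have "(\<lambda>n. whit_int a c (1/3) (X n) / whit_norm a) \<longlonglongrightarrow> whit_norm a / whit_norm a"
        using G X ac that unfolding a_def[symmetric]
        by (intro tendsto_divide tendsto_const whit_int_tendsto_sequentially[where \<delta> = \<delta>]) auto
      then show "(\<lambda>n. F (X n) / (exp (- exp (X n) / 2) * exp (\<kappa> * X n))) \<longlonglongrightarrow> 1"
        using G by (simp add: F_def a_def)
    qed
  qed
qed

section \<open>Uniqueness of the recessive solution\<close>

lemma connected_slit_plane: "connected (- (\<real>\<^sub>\<le>\<^sub>0 :: complex set))"
proof -
  have "(\<real>\<^sub>\<le>\<^sub>0 :: complex set) = of_real ` {..0}" by (auto simp: nonpos_Reals_def)
  then show ?thesis by (metis starlike_imp_connected starlike_slotted_complex_plane_left)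
qed

text \<open>The quotient \<open>h\<close> of two solutions tends to 1, so by Cauchy's estimate \<open>h'\<close> is bounded.
  The (constant) Wronskian is \<open>h' W\<^sub>1\<^sup>2\<close>, which vanishes at infinity because \<open>W\<^sub>1\<close> is recessive.\<close>
lemma is_whittaker_W_unique:
  assumes W1: "is_whittaker_W \<kappa> \<mu> W1" and W2: "is_whittaker_W \<kappa> \<mu> W2" and z: "z \<notin> \<real>\<^sub>\<le>\<^sub>0"
  shows "W1 z = W2 z"
proof -
  let ?S = "- (\<real>\<^sub>\<le>\<^sub>0 :: complex set)"
  let ?E = "\<lambda>\<zeta>. exp (- exp \<zeta> / 2) * exp (\<kappa> * \<zeta>)"
  have oS: "open ?S" by (intro open_Compl closed_nonpos_Reals_complex)
  have lim: "((\<lambda>\<zeta>. W (exp \<zeta>) / ?E \<zeta>) \<longlongrightarrow> 1) (inf (filtercomap Re at_top) (principal {\<zeta>. \<bar>Im \<zeta>\<bar> < pi}))"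
    if W: "is_whittaker_W \<kappa> \<mu> W" for W
  proof -
    obtain F where F: "\<And>\<zeta>. \<bar>Im \<zeta>\<bar> < pi \<Longrightarrow> F \<zeta> = W (exp \<zeta>)"
      "\<And>\<delta>. \<delta> > 0 \<Longrightarrow> ((\<lambda>\<zeta>. F \<zeta> / ?E \<zeta>) \<longlongrightarrow> 1) (inf (filtercomap Re at_top) (principal {\<zeta>. \<bar>Im \<zeta>\<bar> \<le> 3 * pi / 2 - \<delta>}))"
      using W unfolding is_whittaker_W_def by blast
    \<comment> \<open>With \<open>\<delta> = pi/2\<close> the closed subsector already contains the
      strip that \<open>exp\<close> maps onto the slit plane.\<close>
    have "((\<lambda>\<zeta>. F \<zeta> / ?E \<zeta>) \<longlongrightarrow> 1) (inf (filtercomap Re at_top) (principal {\<zeta>. \<bar>Im \<zeta>\<bar> < pi}))"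
      by (rule tendsto_mono[OF _ F(2)[of "pi/2"]], rule inf_mono) auto
    moreover have "\<forall>\<^sub>F \<zeta> in inf (filtercomap Re at_top) (principal {\<zeta>. \<bar>Im \<zeta>\<bar> < pi}). F \<zeta> / ?E \<zeta> = W (exp \<zeta>) / ?E \<zeta>"
      unfolding eventually_inf_principal by (auto simp: F(1))
    ultimately show ?thesis by (rule Lim_transform_eventually)
  qed
  let ?Fl = "inf (filtercomap Re at_top) (principal {\<zeta>. \<bar>Im \<zeta>\<bar> < pi})"
  define h where "h = (\<lambda>\<zeta>. W2 (exp \<zeta>) / W1 (exp \<zeta>))"
  have "((\<lambda>\<zeta>. (W2 (exp \<zeta>) / ?E \<zeta>) / (W1 (exp \<zeta>) / ?E \<zeta>)) \<longlongrightarrow> 1 / 1) ?Fl"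
    by (intro tendsto_divide lim W1 W2) simp
  then have h1: "(h \<longlongrightarrow> 1) ?Fl" by (simp add: h_def)
  \<comment> \<open>Distance below 1 from 1 makes \<open>W1\<close> nonzero and at most twice its
    leading term, and bounds \<open>h - 1\<close> by 1.\<close>
  have "\<forall>\<^sub>F \<zeta> in ?Fl. dist (W1 (exp \<zeta>) / ?E \<zeta>) 1 < 1 \<and> dist (h \<zeta>) 1 < 1"
    by (intro eventually_conj tendstoD[OF h1] tendstoD[OF lim[OF W1]]) auto
  then obtain N where N: "\<And>\<zeta>. Re \<zeta> \<ge> N \<Longrightarrow> \<bar>Im \<zeta>\<bar> < pi \<Longrightarrow> dist (W1 (exp \<zeta>) / ?E \<zeta>) 1 < 1 \<and> dist (h \<zeta>) 1 < 1"
    unfolding eventually_inf_principal eventually_filtercomap_at_top_linorder by blast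
  define S0 where "S0 = {\<zeta>. N < Re \<zeta>} \<inter> {\<zeta>. \<bar>Im \<zeta>\<bar> < pi}"
  have S0: "open S0" "convex S0" unfolding S0_def
    by (auto intro!: open_Int convex_Int open_Im_strip convex_Im_strip open_halfspace_Re_gt convex_halfspace_Re_gt)
  have nz: "W1 (exp \<zeta>) \<noteq> 0" if "\<zeta> \<in> S0" for \<zeta>
    using N[of \<zeta>] that by (auto simp: S0_def)
  have ex: "exp \<zeta> \<in> ?S" if "\<zeta> \<in> S0" for \<zeta>
    using exp_not_nonpos_Reals[of \<zeta>] that by (simp add: S0_def)
  have hol: "W holomorphic_on ?S" and ode: "\<And>z. z \<in> ?S \<Longrightarrow> deriv (deriv W) z = - (- 1 / 4 + \<kappa> / z + (1 / 4 - \<mu>\<^sup>2) / z\<^sup>2) * W z"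
    if "is_whittaker_W \<kappa> \<mu> W" for W
  proof -
    show "W holomorphic_on ?S" using that unfolding is_whittaker_W_def by blast
    show "deriv (deriv W) z = - (- 1 / 4 + \<kappa> / z + (1 / 4 - \<mu>\<^sup>2) / z\<^sup>2) * W z" if "z \<in> ?S" for z
    proof -
      have "deriv (deriv W) z + (- 1 / 4 + \<kappa> / z + (1 / 4 - \<mu>\<^sup>2) / z\<^sup>2) * W z = 0"
        using \<open>is_whittaker_W \<kappa> \<mu> W\<close> that unfolding is_whittaker_W_def by blast
      then show ?thesis unfolding mult_minus_left by (rule eq_neg_iff_add_eq_0[THEN iffD2])
    qed
  qed
  have d1: "(W has_field_derivative deriv W z) (at z)"
    and d2: "(deriv W has_field_derivative - (- 1 / 4 + \<kappa> / z + (1 / 4 - \<mu>\<^sup>2) / z\<^sup>2) * W z) (at z)"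
    if "is_whittaker_W \<kappa> \<mu> W" "z \<in> ?S" for W z
    using holomorphic_derivI[OF hol[OF that(1)] oS that(2)]
      holomorphic_derivI[OF holomorphic_deriv[OF hol[OF that(1)] oS] oS that(2)] ode[OF that]
    by auto
  define w where "w = (\<lambda>z. deriv W2 z * W1 z - W2 z * deriv W1 z)"
  have dw: "(w has_field_derivative 0) (at z)" if "z \<in> ?S" for z
    unfolding w_def
    by (rule derivative_eq_intros d1 d2 W1 W2 that refl)+ (simp add: algebra_simps)
  have "\<exists>C. \<forall>\<zeta>\<in>S0. w (exp \<zeta>) = C"
  proof (rule has_field_derivative_zero_constant[OF S0(2)])
    show "((\<lambda>\<zeta>. w (exp \<zeta>)) has_field_derivative 0) (at \<zeta> within S0)" if "\<zeta> \<in> S0" for \<zeta>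
      using DERIV_chain2[OF dw[OF ex[OF that]] DERIV_exp] by (simp add: has_field_derivative_at_within)
  qed
  then obtain C where C: "\<And>\<zeta>. \<zeta> \<in> S0 \<Longrightarrow> w (exp \<zeta>) = C" by blast
  have dh: "(h has_field_derivative exp \<zeta> * C / (W1 (exp \<zeta>))\<^sup>2) (at \<zeta>)" if "\<zeta> \<in> S0" for \<zeta>
  proof -
    have c: "((\<lambda>\<zeta>. W (exp \<zeta>)) has_field_derivative deriv W (exp \<zeta>) * exp \<zeta>) (at \<zeta>)"
      if "is_whittaker_W \<kappa> \<mu> W" for W
      by (rule DERIV_chain2[OF d1[OF that ex[OF \<open>\<zeta> \<in> S0\<close>]] DERIV_exp])
    show ?thesis unfolding h_def
      by (rule DERIV_cong[OF DERIV_divide[OF c[OF W2] c[OF W1] nz[OF that]]])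
         (simp add: C[OF that, symmetric] w_def power2_eq_square algebra_simps)
  qed
  \<comment> \<open>The unit disc about \<open>t\<close> lies in \<open>S0\<close> because
    \<open>1 < pi\<close> and \<open>t > N + 1\<close>. Cauchy's estimate bounds h'(t) by 1, that is
    e^t |C| \<le> |W1|^2, and |W1|^2 is at most 4 exp(-e^t + 2 Re(\<kappa>) t).\<close>
  have "norm C \<le> 4 * exp (- exp t + (2 * Re \<kappa> - 1) * t)" if t: "t > N + 1" for t
  proof -
    have sub: "cball (of_real t) 1 \<subseteq> S0"
    proof
      fix \<zeta> assume "\<zeta> \<in> cball (complex_of_real t) 1"
      then have "norm (\<zeta> - of_real t) \<le> 1" by (simp add: dist_norm norm_minus_commute)
      then have "\<bar>Re \<zeta> - t\<bar> \<le> 1" "\<bar>Im \<zeta>\<bar> \<le> 1"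
        using abs_Re_le_cmod[of "\<zeta> - of_real t"] abs_Im_le_cmod[of "\<zeta> - of_real t"] by auto
      then show "\<zeta> \<in> S0" using t pi_gt3 by (auto simp: S0_def)
    qed
    then have tS: "of_real t \<in> S0" by (auto simp: subset_iff)
    have hh: "(\<lambda>\<zeta>. h \<zeta> - 1) holomorphic_on S0"
      using dh S0(1) by (intro holomorphic_intros) (auto simp: holomorphic_on_open)
    have "norm ((deriv ^^ 1) (\<lambda>\<zeta>. h \<zeta> - 1) (of_real t)) \<le> fact 1 * 1 / 1 ^ 1"
    proof (rule Cauchy_inequality)
      show "(\<lambda>\<zeta>. h \<zeta> - 1) holomorphic_on ball (of_real t) 1"
        by (rule holomorphic_on_subset[OF hh]) (use sub ball_subset_cball in blast)
      show "continuous_on (cball (of_real t) 1) (\<lambda>\<zeta>. h \<zeta> - 1)"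
        by (intro holomorphic_on_imp_continuous_on holomorphic_on_subset[OF hh sub])
      show "norm (h x - 1) \<le> 1" if "norm (of_real t - x) = 1" for x
      proof -
        have "x \<in> S0" using sub that by (auto simp: subset_iff dist_norm)
        then show ?thesis using N[of x] by (auto simp: S0_def dist_norm)
      qed
    qed auto
    moreover have "deriv (\<lambda>\<zeta>. h \<zeta> - 1) (of_real t) = exp (of_real t) * C / (W1 (exp (of_real t)))\<^sup>2"
      by (rule DERIV_imp_deriv) (use dh[OF tS] in \<open>auto intro!: derivative_eq_intros\<close>)
    ultimately have "norm (exp (of_real t) * C / (W1 (exp (of_real t)))\<^sup>2) \<le> 1" by simp
    then have 1: "exp t * norm C \<le> (norm (W1 (exp (of_real t))))\<^sup>2"
      using nz[OF tS] by (simp add: norm_mult norm_divide norm_power divide_le_eq)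
    have "norm (W1 (exp (of_real t)) / ?E (of_real t)) \<le> 2"
      using N[of "of_real t"] tS norm_triangle_ineq2[of "W1 (exp (of_real t)) / ?E (of_real t)" 1]
      by (auto simp: S0_def dist_norm)
    then have "norm (W1 (exp (of_real t))) \<le> 2 * norm (?E (of_real t))"
      by (simp add: norm_divide divide_le_eq)
    then have "(norm (W1 (exp (of_real t))))\<^sup>2 \<le> (2 * norm (?E (of_real t)))\<^sup>2"
      by (intro power_mono) auto
    also have "\<dots> = 4 * exp (- exp t + 2 * Re \<kappa> * t)"
      by (simp add: norm_mult power_mult_distrib Re_exp flip: exp_add exp_double)
    also have "\<dots> = exp t * (4 * exp (- exp t + (2 * Re \<kappa> - 1) * t))"
      by (simp add: algebra_simps flip: exp_add)
    finally have "exp t * norm C \<le> exp t * (4 * exp (- exp t + (2 * Re \<kappa> - 1) * t))"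
      using 1 by linarith
    then show ?thesis by simp
  qed
  then have "\<forall>\<^sub>F t in at_top. norm C \<le> 4 * exp (- exp t + (2 * Re \<kappa> - 1) * t)"
    by (rule eventually_mono[OF eventually_gt_at_top[of "N + 1"]])
  then have "norm C \<le> 0"
  proof (rule tendsto_lowerbound[rotated])
    show "((\<lambda>t::real. 4 * exp (- exp t + (2 * Re \<kappa> - 1) * t)) \<longlongrightarrow> 0) at_top" by real_asymp
  qed simp
  then have C0: "C = 0" by simp
  have "\<exists>k. \<forall>\<zeta>\<in>S0. h \<zeta> = k"
    by (rule has_field_derivative_zero_constant[OF S0(2)])
       (use has_field_derivative_at_within[OF dh] C0 in simp)
  then obtain k where k: "\<And>\<zeta>. \<zeta> \<in> S0 \<Longrightarrow> h \<zeta> = k" by blast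
  have rS: "of_real t \<in> S0" if "t > N" for t using that by (simp add: S0_def)
  have "filterlim complex_of_real ?Fl at_top"
    by (simp add: filterlim_inf filterlim_principal filterlim_filtercomap_iff o_def filterlim_ident)
  from filterlim_compose[OF h1 this] have "((\<lambda>t. h (of_real t)) \<longlongrightarrow> 1) at_top" .
  moreover have "\<forall>\<^sub>F t in at_top. h (of_real t) = k"
    using eventually_gt_at_top[of N] by eventually_elim (simp add: k rS)
  ultimately have "((\<lambda>t::real. k) \<longlongrightarrow> 1) at_top" by (rule Lim_transform_eventually)
  then have k1: "k = 1" by (simp add: tendsto_const_iff)
  \<comment> \<open>The real ray on which both solutions agree, as input to the identity
    theorem.\<close>
  define U where "U = (\<lambda>t. exp (complex_of_real t)) ` {N<..}"
  have "W1 z - W2 z = 0"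
  proof (rule analytic_continuation[where f = "\<lambda>z. W1 z - W2 z" and S = ?S and U = U and \<xi> = "exp (of_real (N + 1))"])
    show "(\<lambda>z. W1 z - W2 z) holomorphic_on ?S" by (intro holomorphic_intros hol W1 W2)
    show "U \<subseteq> ?S" using ex rS by (auto simp: U_def)
    show "exp (of_real (N + 1)) \<in> ?S" by (intro ex rS) simp
    have "connected U" unfolding U_def by (intro connected_continuous_image continuous_intros) auto
    moreover have "exp (of_real (N + 1)) \<in> U" "exp (of_real (N + 2)) \<in> U"
      unfolding U_def by (intro image_eqI[OF refl]; simp)+
    moreover have "exp (complex_of_real (N + 1)) \<noteq> exp (complex_of_real (N + 2))"
      unfolding exp_of_real of_real_eq_iff by simp
    ultimately show "exp (complex_of_real (N + 1)) islimpt U"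
      by (intro connected_imp_perfect) auto
    show "W1 u - W2 u = 0" if "u \<in> U" for u
    proof -
      obtain t where t: "u = exp (of_real t)" "t > N" using \<open>u \<in> U\<close> by (auto simp: U_def)
      then have "h (of_real t) = 1" using k[OF rS] k1 by simp
      then show ?thesis using nz[OF rS[OF t(2)]] by (simp add: h_def t)
    qed
  qed (use z oS connected_slit_plane in auto)
  then show ?thesis by simp
qed

section \<open>Behaviour near the origin and the effective temperature\<close>

text \<open>The arguments of z and 1 + t/z are at most \<open>pi / 2\<close> and below
  \<open>pi / 2\<close> in modulus, so their logarithms add without a jump. The imaginary axis,
  where \<open>n_SJ\<close> evaluates the Whittaker function, is included.\<close>

lemma whit_v_right_half_plane:
  assumes "0 \<le> Re z" "z \<noteq> 0"
  shows "whit_v a c z = (\<integral>t. exp (- exp (of_real t)) * exp (a * of_real t) *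
    exp (- c * Ln (exp (of_real t) + z)) \<partial>lborel)"
proof -
  have "Ln (exp (of_real t) + z) = Ln z + Ln (1 + exp (of_real t - Ln z))" for t :: real
  proof -
    let ?u = "1 + exp (of_real t - Ln z)"
    have u: "?u = 1 + exp (of_real t) / z" using assms by (simp add: exp_diff)
    have "0 \<le> Re (exp (of_real t) / z)"
      using assms by (simp add: Re_divide exp_of_real flip: power2_eq_square)
    then have "0 < Re ?u" unfolding u by simp
    moreover from this have "?u \<noteq> 0" by (metis less_irrefl zero_complex.sel(1))
    ultimately have "\<bar>Im (Ln ?u)\<bar> < pi / 2" "?u \<noteq> 0" using Re_Ln_pos_lt by blast+
    moreover have "\<bar>Im (Ln z)\<bar> \<le> pi / 2" using assms Re_Ln_pos_le by blast
    ultimately have "Ln (z * ?u) = Ln z + Ln ?u" using assms by (intro Ln_times_simple) auto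
    moreover have "z * ?u = exp (of_real t) + z" unfolding u using assms by (simp add: field_simps)
    ultimately show ?thesis by simp
  qed
  then have "exp (- c * Ln z) * whit_kernel a c 0 t (Ln z) = exp (- exp (of_real t)) * exp (a * of_real t) *
    exp (- c * Ln (exp (of_real t) + z))" for t
    by (simp add: whit_kernel_def distrib_left exp_diff exp_minus field_simps exp_add)
  then show ?thesis unfolding whit_v_def whit_int_def
    by (simp only: integral_mult_right_zero[symmetric])
qed

text \<open>Since \<open>Re (Z n) \<ge> 0\<close>, |t + Z| \<ge> t. Hence e^(-t) t^(1/2) dt/t, up to
  a constant, dominates the integrand of v, and it is also the limit, with integral Gamma(1/2) =
  sqrt(pi).\<close>

lemma
  fixes \<kappa> Z :: "nat \<Rightarrow> complex"
  assumes \<kappa>: "\<kappa> \<longlonglongrightarrow> 0" "\<And>n. Re (\<kappa> n) = 0"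
    and Z: "Z \<longlonglongrightarrow> 0" "\<And>n. 0 \<le> Re (Z n)" "\<And>n. Z n \<noteq> 0"
  shows whit_v_tendsto: "(\<lambda>n. whit_v (3/4 - \<kappa> n) (1/4 - \<kappa> n) (Z n)) \<longlonglongrightarrow> of_real (sqrt pi)"
    and whit_v_plus_one_tendsto: "(\<lambda>n. Z n * whit_v (3/4 - \<kappa> n) (1/4 - \<kappa> n + 1) (Z n)) \<longlonglongrightarrow> 0"
    and whit_norm_tendsto: "(\<lambda>n. whit_norm (3/4 - \<kappa> n)) \<longlonglongrightarrow> of_real (Gamma (3/4))"
proof -
  define e where "e = (\<lambda>t::real. exp (of_real t) :: complex)"
  define K where "K = (\<lambda>n t. exp (- e t) * exp ((3/4 - \<kappa> n) * of_real t))"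
  define J where "J = (\<lambda>n t. exp (- (1/4 - \<kappa> n) * Ln (e t + Z n)))"
  define g where "g b = (\<lambda>t. exp (- exp t) * exp (b * t))" for b :: real
  have gi: "integrable lborel (g b)" and gv: "(\<integral>t. g b t \<partial>lborel) = Gamma b" if "b > 0" for b
    using integral_exp_exp[of 1 b] that by (auto simp: g_def)
  have np: "e t + Z n \<notin> \<real>\<^sub>\<le>\<^sub>0" for t n
    using add_pos_nonneg[OF exp_gt_zero[of t] Z(2)[of n]]
    by (auto simp: complex_nonpos_Reals_iff e_def Re_exp)
  have nz: "e t + Z n \<noteq> 0" for t n using np[of t n] by auto
  have Kn: "norm (K n t) = g (3/4) t" for n t
    using \<kappa>(2)[of n] by (simp add: K_def g_def norm_mult e_def Re_exp)
  have Km: "K n \<in> borel_measurable lborel" for n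
  proof -
    have "continuous_on UNIV (K n)" unfolding K_def e_def by (intro continuous_intros)
    then show ?thesis using borel_measurable_continuous_onI by simp
  qed
  have ce: "continuous_on UNIV e" unfolding e_def by (intro continuous_intros)
  have Jc: "continuous_on UNIV (\<lambda>t. exp (- d * Ln (e t + Z n)))" for n d
    using np by (intro continuous_intros ce) auto
  have Jm: "J n \<in> borel_measurable lborel" for n
  proof -
    have "J n \<in> borel_measurable borel" unfolding J_def by (rule borel_measurable_continuous_onI[OF Jc])
    then show ?thesis by simp
  qed
  obtain B where B: "\<And>n. norm (\<kappa> n) \<le> B"
    using convergent_imp_Bseq[OF convergentI[OF \<kappa>(1)]] unfolding Bseq_def by blast
  \<comment> \<open>As \<open>Re (\<kappa> n) = 0\<close>, the exponent -1/4 governs the modulus,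
    and the imaginary part of \<open>\<kappa> n\<close> costs at most
    \<open>exp (B * pi)\<close>.\<close>
  have Jb: "norm (J n t) \<le> exp (B * pi) * exp (- t / 4)" for n t
  proof -
    let ?L = "Ln (e t + Z n)"
    have "exp t \<le> Re (e t + Z n)" using Z(2)[of n] by (simp add: e_def Re_exp)
    also have "\<dots> \<le> norm (e t + Z n)" by (rule complex_Re_le_cmod)
    finally have "t \<le> Re ?L" using nz[of t n] by (simp add: Re_Ln ln_ge_iff)
    moreover have "\<bar>Im ?L\<bar> \<le> pi" using abs_Im_Ln_less_pi[OF np] by (simp add: less_imp_le)
    then have "\<bar>Im (\<kappa> n) * Im ?L\<bar> \<le> B * pi"
      using order_trans[OF abs_Im_le_cmod B, of n] unfolding abs_mult by (intro mult_mono) auto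
    ultimately have "Re (- (1/4 - \<kappa> n) * ?L) \<le> B * pi + - t / 4"
      using \<kappa>(2)[of n] by (simp add: abs_le_iff)
    then show ?thesis by (simp add: J_def flip: exp_add)
  qed
  have g2: "g (3/4) t * exp (- t / 4) = g (1/2) t" for t
    by (simp add: g_def flip: exp_add)
  have Kl: "(\<lambda>n. K n t) \<longlonglongrightarrow> exp (- e t) * exp ((3/4 - 0) * of_real t)" for t
    unfolding K_def by (intro tendsto_intros \<kappa>)
  have Lt: "Ln (e t) = of_real t" for t by (simp add: e_def)
  have enp: "e t \<notin> \<real>\<^sub>\<le>\<^sub>0" for t unfolding e_def exp_of_real by simp
  have Ll: "(\<lambda>n. Ln (e t + Z n)) \<longlonglongrightarrow> of_real t" for t
    using tendsto_Ln[OF tendsto_add[OF tendsto_const Z(1)], of "e t"] enp by (simp add: Lt)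
  have Jl: "(\<lambda>n. J n t) \<longlonglongrightarrow> exp (- (1/4 - 0) * of_real t)" for t
    unfolding J_def by (intro tendsto_intros \<kappa> Ll)
  have v: "whit_v (3/4 - \<kappa> n) (1/4 - \<kappa> n) (Z n) = (\<integral>t. K n t * J n t \<partial>lborel)" for n
    unfolding whit_v_right_half_plane[OF Z(2,3)] K_def J_def e_def ..
  have KJb: "norm (K n t * J n t) \<le> exp (B * pi) * g (1/2) t" for n t
  proof -
    have "norm (K n t * J n t) \<le> g (3/4) t * (exp (B * pi) * exp (- t / 4))"
      unfolding norm_mult Kn using Jb[of n t] by (rule mult_left_mono) (simp add: g_def)
    also have "\<dots> = exp (B * pi) * g (1/2) t" by (simp only: g2[symmetric] mult_ac)
    finally show ?thesis .
  qed
  have lim1: "exp (- e t) * exp ((3/4 - 0) * of_real t) * exp (- (1/4 - 0) * of_real t) = of_real (g (1/2) t)" for t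
  proof -
    have "- e t + (3/4 - 0) * of_real t + - (1/4 - 0) * of_real t = of_real (- exp t + 1/2 * t)"
      by (simp add: e_def exp_of_real algebra_simps)
    then show ?thesis unfolding exp_add[symmetric] g_def by (simp only: exp_of_real)
  qed
  have "(\<lambda>n. \<integral>t. K n t * J n t \<partial>lborel) \<longlonglongrightarrow> (\<integral>t. complex_of_real (g (1/2) t) \<partial>lborel)"
  proof (rule integral_dominated_convergence)
    show "integrable lborel (\<lambda>t. exp (B * pi) * g (1/2) t)" using gi[of "1/2"] by simp
    show "AE t in lborel. (\<lambda>n. K n t * J n t) \<longlonglongrightarrow> complex_of_real (g (1/2) t)"
    proof (intro AE_I2)
      show "(\<lambda>n. K n t * J n t) \<longlonglongrightarrow> complex_of_real (g (1/2) t)" for t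
        using tendsto_mult[OF Kl[of t] Jl[of t]] unfolding lim1 .
    qed
  qed (use KJb Km Jm gi[of "1/2"] in auto)
  then show "(\<lambda>n. whit_v (3/4 - \<kappa> n) (1/4 - \<kappa> n) (Z n)) \<longlonglongrightarrow> of_real (sqrt pi)"
    unfolding v using gv[of "1/2"] by (simp add: Gamma_one_half_real)
  \<comment> \<open>For the exponent c + 1 alone the limiting integrand is not integrable at t = 0.
    Keeping \<open>Z n\<close> inside produces the factor Z / (t + Z), bounded by 1 and tending to 0
    pointwise.\<close>
  have v1: "Z n * whit_v (3/4 - \<kappa> n) (1/4 - \<kappa> n + 1) (Z n) = (\<integral>t. K n t * J n t * (Z n / (e t + Z n)) \<partial>lborel)" for n
  proof -
    have "Z n * (exp (- e t) * exp ((3/4 - \<kappa> n) * of_real t) * exp (- (1/4 - \<kappa> n + 1) * Ln (e t + Z n)))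
      = K n t * J n t * (Z n / (e t + Z n))" for t
      unfolding exp_neg_plus_one_mult_Ln[OF nz] by (simp add: K_def J_def)
    then show ?thesis
      unfolding whit_v_right_half_plane[OF Z(2,3)] integral_mult_right_zero[symmetric] e_def by simp
  qed
  have q: "norm (Z n / (e t + Z n)) \<le> 1" for n t
  proof -
    have "(norm (Z n))\<^sup>2 \<le> (norm (e t + Z n))\<^sup>2"
      unfolding cmod_power2 e_def using Z(2)[of n] exp_gt_zero[of t]
      by (intro add_mono) (auto simp: Re_exp Im_exp intro!: power_mono)
    then have "norm (Z n) \<le> norm (e t + Z n)" by (rule power2_le_imp_le) simp
    then show ?thesis using nz[of t n] by (simp add: norm_divide divide_le_eq)
  qed
  have "(\<lambda>n. \<integral>t. K n t * J n t * (Z n / (e t + Z n)) \<partial>lborel) \<longlonglongrightarrow> (\<integral>t. (0::complex) \<partial>(lborel :: real measure))"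
  proof (rule integral_dominated_convergence)
    show "integrable lborel (\<lambda>t. exp (B * pi) * g (1/2) t)" using gi[of "1/2"] by simp
    show "AE t in lborel. (\<lambda>n. K n t * J n t * (Z n / (e t + Z n))) \<longlonglongrightarrow> 0"
    proof (intro AE_I2)
      fix t
      have "e t \<noteq> 0" by (simp add: e_def)
      then have "(\<lambda>n. K n t * J n t * (Z n / (e t + Z n))) \<longlonglongrightarrow>
         exp (- e t) * exp ((3/4 - 0) * of_real t) * exp (- (1/4 - 0) * of_real t) * (0 / (e t + 0))"
        by (intro tendsto_intros Kl Jl Z) auto
      then show "(\<lambda>n. K n t * J n t * (Z n / (e t + Z n))) \<longlonglongrightarrow> 0" by simp
    qed
    show "AE t in lborel. norm (K n t * J n t * (Z n / (e t + Z n))) \<le> exp (B * pi) * g (1/2) t" for n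
      using mult_mono[OF KJb q] unfolding norm_mult[symmetric] by (auto simp: g_def)
    show "(\<lambda>t. K n t * J n t * (Z n / (e t + Z n))) \<in> borel_measurable lborel" for n
      using Km Jm borel_measurable_continuous_onI[OF ce] by simp
  qed simp
  then show "(\<lambda>n. Z n * whit_v (3/4 - \<kappa> n) (1/4 - \<kappa> n + 1) (Z n)) \<longlonglongrightarrow> 0"
    unfolding v1 by simp
  have G: "whit_norm (3/4 - \<kappa> n) = (\<integral>t. K n t \<partial>lborel)" for n
    by (simp add: whit_norm_def whit_int_def whit_kernel_def K_def e_def)
  have lim2: "exp (- e t) * exp ((3/4 - 0) * of_real t) = of_real (g (3/4) t)" for t
    by (simp add: g_def e_def flip: exp_of_real)
  have "(\<lambda>n. \<integral>t. K n t \<partial>lborel) \<longlonglongrightarrow> (\<integral>t. complex_of_real (g (3/4) t) \<partial>lborel)"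
  proof (rule integral_dominated_convergence)
    show "integrable lborel (g (3/4))" using gi[of "3/4"] by simp
    show "AE t in lborel. (\<lambda>n. K n t) \<longlonglongrightarrow> complex_of_real (g (3/4) t)"
      using Kl unfolding lim2 by blast
  qed (use Kn Km gi[of "3/4"] in auto)
  then show "(\<lambda>n. whit_norm (3/4 - \<kappa> n)) \<longlonglongrightarrow> of_real (Gamma (3/4))"
    unfolding G using gv[of "3/4"] by simp
qed

section \<open>Occupation number and temperature in the variables \<open>x\<close> and
  \<open>s\<close>\<close>

lemma whittaker_W_eq_whit_W:
  assumes "Re \<kappa> \<le> 1/4" "whit_norm (3/4 - \<kappa>) \<noteq> 0" "z \<notin> \<real>\<^sub>\<le>\<^sub>0"
  shows "whittaker_W \<kappa> (1/4) z = whit_W \<kappa> z"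
    and "deriv (whittaker_W \<kappa> (1/4)) z = deriv (whit_W \<kappa>) z"
proof -
  have W: "is_whittaker_W \<kappa> (1/4) (whit_W \<kappa>)" using assms by (intro is_whittaker_W_whit_W)
  \<comment> \<open>Existence makes the choice operator return a genuine solution; uniqueness then
    identifies it with \<open>whit_W\<close> off the cut.\<close>
  then have "is_whittaker_W \<kappa> (1/4) (whittaker_W \<kappa> (1/4))" unfolding whittaker_W_def by (rule someI[where P = "is_whittaker_W \<kappa> (1/4)"])
  then have eq: "whittaker_W \<kappa> (1/4) z = whit_W \<kappa> z" if "z \<notin> \<real>\<^sub>\<le>\<^sub>0" for z
    using W that by (rule is_whittaker_W_unique)
  then show "whittaker_W \<kappa> (1/4) z = whit_W \<kappa> z" using assms by blast
  show "deriv (whittaker_W \<kappa> (1/4)) z = deriv (whit_W \<kappa>) z"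
    using assms(3) eq
    by (intro deriv_cong_ev eventually_nhds_in_open[THEN eventually_mono, of "- \<real>\<^sub>\<le>\<^sub>0"]) auto
qed

text \<open>For z = i x with x > 0 the factor |exp(-z/2) z^(1/4)|^2 is sqrt(x). \<open>SJ_A\<close>,
  and \<open>SJ_B\<close> below, are |W|^2 and |2 z W' - 3 W/2|^2 with this factor removed, so that
  they have finite limits.\<close>

definition SJ_A :: "complex \<Rightarrow> complex \<Rightarrow> real" where
  "SJ_A \<kappa> z = (norm (whit_v (3/4 - \<kappa>) (1/4 - \<kappa>) z / whit_norm (3/4 - \<kappa>)))\<^sup>2"

definition SJ_B :: "complex \<Rightarrow> complex \<Rightarrow> real" where
  "SJ_B \<kappa> z = (norm (((z + 1) * whit_v (3/4 - \<kappa>) (1/4 - \<kappa>) z +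
     2 * (1/4 - \<kappa>) * (z * whit_v (3/4 - \<kappa>) (1/4 - \<kappa> + 1) z)) / whit_norm (3/4 - \<kappa>)))\<^sup>2"

text \<open>As p^2/m^2 + 1 = (4 s + x)/x, multiplying by \<open>x * sqrt (4 * s + x)\<close> removes
  every factor that blows up in the regime considered.\<close>

lemma n_SJ_eq:
  assumes "m > 0" "H > 0"
    and x: "x = m / H" and s: "s = p\<^sup>2 / (4 * m * H)"
    and \<kappa>: "\<kappa> = - \<i> * of_real s" and z: "z = \<i> * of_real x"
    and G: "whit_norm (3/4 - \<kappa>) \<noteq> 0"
  shows "n_SJ m H p * (x * sqrt (4 * s + x)) =
    1/4 * exp (- pi * s) * ((4 * s + x) * x * SJ_A \<kappa> z + SJ_B \<kappa> z) - 1/2 * (x * sqrt (4 * s + x))"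
proof -
  have x0: "x > 0" and s0: "s \<ge> 0" using assms by auto
  have znp: "z \<notin> \<real>\<^sub>\<le>\<^sub>0" and z0: "z \<noteq> 0" using x0 by (auto simp: z complex_nonpos_Reals_iff)
  have k: "Re \<kappa> \<le> 1/4" by (simp add: \<kappa>)
  define W where "W = whittaker_W \<kappa> (1/4)"
  define v where "v = whit_v (3/4 - \<kappa>) (1/4 - \<kappa>) z"
  define v1 where "v1 = whit_v (3/4 - \<kappa>) (1/4 - \<kappa> + 1) z"
  define g where "g = whit_norm (3/4 - \<kappa>)"
  define E where "E = exp (- z / 2) * exp (Ln z / 4)"
  have W: "W z = E * (v / g)"
    unfolding W_def whittaker_W_eq_whit_W[OF k G znp] by (simp add: whit_W_def E_def v_def g_def)
  have dW: "deriv W z = E / g * ((- 1/2 + 1 / (4 * z)) * v - (1/4 - \<kappa>) * v1)"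
    unfolding W_def whittaker_W_eq_whit_W[OF k G znp] E_def v_def v1_def g_def
    by (rule DERIV_imp_deriv[OF has_field_derivative_whit_W[OF k znp]])
  \<comment> \<open>The contributions 1/2 from \<open>2 * z * (1 / (4 * z))\<close> and -3/2 add up
    to -1, whence \<open>z + 1\<close> once the sign is pulled out.\<close>
  have D: "2 * z * deriv W z - 3/2 * W z = - E * (((z + 1) * v + 2 * (1/4 - \<kappa>) * (z * v1)) / g)"
    unfolding dW W using z0 G by (simp add: field_simps g_def)
  have "norm E = exp (Re (Ln z) / 4)" by (simp add: E_def norm_mult z)
  also have "Re (Ln z) = ln x" using z0 x0 by (simp add: Re_Ln z norm_mult)
  finally have "(norm E)\<^sup>2 = exp (ln x / 2)" by (simp flip: exp_double)
  also have "\<dots> = sqrt x" using x0 by (simp add: powr_half_sqrt[symmetric] powr_def)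
  finally have E2: "(norm E)\<^sup>2 = sqrt x" .
  have nW: "(norm (W z))\<^sup>2 = sqrt x * SJ_A \<kappa> z"
    unfolding W SJ_A_def norm_mult power_mult_distrib E2 by (simp add: v_def g_def)
  have nD: "(norm (2 * z * deriv W z - 3/2 * W z))\<^sup>2 = sqrt x * SJ_B \<kappa> z"
    unfolding D SJ_B_def norm_mult norm_minus_cancel power_mult_distrib E2 by (simp add: v_def v1_def g_def)
  have r: "p\<^sup>2 / m\<^sup>2 + 1 = (4 * s + x) / x"
    using assms(1,2) by (simp add: s x field_simps power2_eq_square)
  have ek: "exp (- \<i> * of_real pi * \<kappa>) = of_real (exp (- pi * s))"
  proof -
    have "- \<i> * of_real pi * \<kappa> = of_real (- pi * s)" by (simp add: \<kappa> complex_eq_iff)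
    then show ?thesis by (simp only: exp_of_real)
  qed
  have z2: "1 / z\<^sup>2 = - of_real (1 / x\<^sup>2)" by (simp add: z power_mult_distrib)
  have zz: "\<i> * of_real (m / H) = z" by (simp add: z x)
  have kk: "- \<i> * of_real (p\<^sup>2 / (4 * m * H)) = \<kappa>" by (simp add: \<kappa> s)
  have "n_SJ m H p = 1/4 * (exp (- pi * s) / sqrt ((4 * s + x) / x)) *
     ((4 * s + x) / x * (sqrt x * SJ_A \<kappa> z) + 1 / x\<^sup>2 * (sqrt x * SJ_B \<kappa> z)) - 1/2"
    unfolding n_SJ_def Let_def zz kk r ek z2 W_def[symmetric] nW nD
    by (simp flip: of_real_mult of_real_add of_real_divide of_real_diff)
  moreover have "x * sqrt (4 * s + x) * (1/4 * (e / sqrt ((4 * s + x) / x)) *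
     ((4 * s + x) / x * (sqrt x * A) + 1 / x\<^sup>2 * (sqrt x * B))) = 1/4 * e * ((4 * s + x) * x * A + B)" for e A B
  proof -
    have "x * sqrt (4 * s + x) * (1/4 * (e / sqrt ((4 * s + x) / x)) *
     ((4 * s + x) / x * (sqrt x * A) + 1 / x\<^sup>2 * (sqrt x * B))) =
      1/4 * e * (x * (sqrt x * sqrt x) * ((4 * s + x) / x * A + 1 / x\<^sup>2 * B))"
    proof -
      have *: "x * R * (1/4 * (e / (R / q)) * (j * (q * A) + k * (q * B))) = 1/4 * e * (x * (q * q) * (j * A + k * B))"
        if "R \<noteq> 0" "q \<noteq> 0" for R q j k :: real using that by (simp add: field_simps)
      show ?thesis unfolding real_sqrt_divide by (rule *) (use x0 s0 in auto)
    qed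
    also have "\<dots> = 1/4 * e * ((4 * s + x) * x * A + B)"
      using x0 by (simp add: field_simps power2_eq_square)
    finally show ?thesis .
  qed
  ultimately show ?thesis by (simp only: left_diff_distrib) (simp only: mult.commute[of _ "x * sqrt (4 * s + x)"])
qed

text \<open>The factor multiplying \<open>n_SJ\<close> is also
  \<open>sqrt (p\<^sup>2 + m\<^sup>2)\<close> measured in units of
  \<open>H powr (3/2) / sqrt m\<close>. With u = 1 / \<open>n_SJ\<close> the ratio is therefore P/C
  times u / ln(1 + u).\<close>

lemma T_SJ_ratio_eq:
  assumes "m > 0" "H > 0" and x: "x = m / H" and s: "s = p\<^sup>2 / (4 * m * H)"
    and n: "n_SJ m H p * (x * sqrt (4 * s + x)) = P" and P: "P > 0"
  shows "T_SJ m H p / (C * (H powr (3/2) / sqrt m)) =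
    (P / C) * ((x * sqrt (4 * s + x) / P) / ln (1 + x * sqrt (4 * s + x) / P))"
proof -
  have x0: "x > 0" and s0: "s \<ge> 0" using assms by auto
  define y where "y = x * sqrt (4 * s + x)"
  have y0: "y > 0" using x0 s0 by (simp add: y_def)
  have "n_SJ m H p = P / y" using n y0 by (simp add: eq_divide_eq flip: y_def)
  then have n1: "1 / n_SJ m H p = y / P" by simp
  have "p\<^sup>2 + m\<^sup>2 = m\<^sup>2 * ((4 * s + x) / x)"
    using assms(1,2) by (simp add: s x field_simps power2_eq_square)
  then have R: "sqrt (p\<^sup>2 + m\<^sup>2) = m * (sqrt (4 * s + x) / sqrt x)"
    using assms(1) by (simp add: real_sqrt_mult real_sqrt_divide)
  have Hp: "H powr (3/2) = H * sqrt H"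
    using assms(2) powr_add[of H 1 "1/2"] by (simp add: powr_half_sqrt)
  have sx: "sqrt m / sqrt H = sqrt x" by (simp add: x real_sqrt_divide)
  have "sqrt (p\<^sup>2 + m\<^sup>2) / (H powr (3/2) / sqrt m) =
      (m / H) * sqrt (4 * s + x) * ((sqrt m / sqrt H) / sqrt x)"
    unfolding R Hp by (simp only: times_divide_eq_left times_divide_eq_right divide_divide_eq_left divide_divide_eq_right mult_ac)
  also have "\<dots> = y"
    unfolding sx x[symmetric] using x0 by (simp add: y_def)
  finally have r: "sqrt (p\<^sup>2 + m\<^sup>2) / (H powr (3/2) / sqrt m) = y" .
  have frac: "a / L / (C * D) = (a / D) / (C * L)" for a L D :: real by (simp add: mult_ac)
  have "T_SJ m H p / (C * (H powr (3/2) / sqrt m)) = y / (C * ln (1 + y / P))"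
    unfolding T_SJ_def n1 by (subst frac) (simp only: r)
  also have "\<dots> = (P / C) * ((y / P) / ln (1 + y / P))" using P by simp
  finally show ?thesis by (simp add: y_def)
qed

text \<open>Balls of radius \<open>1 / real (Suc n)\<close> give a countable base, which reduces the
  limit in three parameters to sequences.\<close>

lemma tendsto_filtercomap_nhds_principal:
  fixes r :: "'a \<Rightarrow> 'c :: metric_space" and f :: "'a \<Rightarrow> 'b :: topological_space"
  assumes "\<And>X. (\<And>n. X n \<in> S) \<Longrightarrow> (\<lambda>n. r (X n)) \<longlonglongrightarrow> c \<Longrightarrow> (\<lambda>n. f (X n)) \<longlonglongrightarrow> l"
  shows "(f \<longlongrightarrow> l) (inf (filtercomap r (nhds c)) (principal S))"
proof (rule topological_tendstoI, rule ccontr)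
  fix U assume U: "open U" "l \<in> U"
    and neg: "\<not> (\<forall>\<^sub>F x in inf (filtercomap r (nhds c)) (principal S). f x \<in> U)"
  have "\<forall>n. \<exists>x. dist (r x) c < 1 / real (Suc n) \<and> x \<in> S \<and> f x \<notin> U"
  proof (rule ccontr)
    assume "\<not> ?thesis"
    then obtain n where n: "\<And>x. dist (r x) c < 1 / real (Suc n) \<Longrightarrow> x \<in> S \<Longrightarrow> f x \<in> U" by blast
    have "\<forall>\<^sub>F u in nhds c. dist u c < 1 / real (Suc n)"
      by (intro tendstoD filterlim_ident) simp
    then have "\<forall>\<^sub>F x in filtercomap r (nhds c). dist (r x) c < 1 / real (Suc n)"
      by (rule eventually_filtercomapI)
    then have "\<forall>\<^sub>F x in inf (filtercomap r (nhds c)) (principal S). f x \<in> U"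
      unfolding eventually_inf_principal by (rule eventually_mono) (use n in blast)
    then show False using neg by blast
  qed
  then obtain X where X: "\<And>n. dist (r (X n)) c < 1 / real (Suc n)" "\<And>n. X n \<in> S" "\<And>n. f (X n) \<notin> U"
    by meson
  have "(\<lambda>n. dist (r (X n)) c) \<longlonglongrightarrow> 0"
  proof (rule tendsto_sandwich[OF _ _ tendsto_const LIMSEQ_inverse_real_of_nat])
    show "\<forall>\<^sub>F n in sequentially. dist (r (X n)) c \<le> inverse (real (Suc n))"
      unfolding inverse_eq_divide by (intro always_eventually allI less_imp_le X)
  qed simp
  then have "(\<lambda>n. r (X n)) \<longlonglongrightarrow> c" by (rule tendsto_dist_iff[THEN iffD2])
  then have "(\<lambda>n. f (X n)) \<longlonglongrightarrow> l" using assms X(2) by blast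
  from topological_tendstoD[OF this U] X(3) show False by simp
qed

section \<open>The limit along an arbitrary sequence of parameters\<close>

theorem mainTheorem3:
  shows "((\<lambda>(m, H, p). T_SJ m H p /
            (pi / (4 * \<bar>Gamma (3 / 4 :: real)\<bar>\<^sup>2) * (H powr (3 / 2) / sqrt m))) \<longlongrightarrow> 1)
         (inf (filtercomap (\<lambda>(m, H, p). (m / H, p / sqrt (m * H))) (nhds (0, 0)))
              (principal {(m, H, p). m > 0 \<and> H > 0 \<and> p \<ge> 0}))"
proof (rule tendsto_filtercomap_nhds_principal)
  fix X :: "nat \<Rightarrow> real \<times> real \<times> real"
  assume XS: "\<And>n. X n \<in> {(m, H, p). m > 0 \<and> H > 0 \<and> p \<ge> 0}"
    and Xlim: "(\<lambda>n. case X n of (m, H, p) \<Rightarrow> (m / H, p / sqrt (m * H))) \<longlonglongrightarrow> (0, 0)"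
  define m H p where "m n = fst (X n)" and "H n = fst (snd (X n))" and "p n = snd (snd (X n))" for n
  have X: "X n = (m n, H n, p n)" for n by (simp add: m_def H_def p_def)
  have pos: "m n > 0" "H n > 0" for n using XS[of n] by (auto simp: X)
  define x s where "x n = m n / H n" and "s n = (p n)\<^sup>2 / (4 * m n * H n)" for n
  define \<kappa> Z where "\<kappa> n = - \<i> * of_real (s n)" and "Z n = \<i> * of_real (x n)" for n
  have x0: "x n > 0" and s0: "s n \<ge> 0" for n using pos[of n] by (auto simp: x_def s_def)
  have xl: "x \<longlonglongrightarrow> 0" using tendsto_fst[OF Xlim] by (simp add: X x_def[abs_def])
  \<comment> \<open>\<open>s\<close> is a quarter of the square of the second small
    parameter.\<close>
  have "(\<lambda>n. (p n / sqrt (m n * H n))\<^sup>2 / 4) \<longlonglongrightarrow> 0\<^sup>2 / 4"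
    using tendsto_snd[OF Xlim] by (intro tendsto_intros) (simp_all add: X)
  moreover have "(p n / sqrt (m n * H n))\<^sup>2 / 4 = s n" for n
    using pos[of n] by (simp add: s_def power_divide)
  ultimately have sl: "s \<longlonglongrightarrow> 0" by simp
  have "(\<lambda>n. of_real (s n) :: complex) \<longlonglongrightarrow> 0" "(\<lambda>n. of_real (x n) :: complex) \<longlonglongrightarrow> 0"
    using tendsto_of_real[OF sl] tendsto_of_real[OF xl] by simp_all
  from tendsto_mult_right_zero[OF this(1), of "- \<i>"] tendsto_mult_right_zero[OF this(2), of "\<i>"]
  have \<kappa>l: "\<kappa> \<longlonglongrightarrow> 0" and Zl: "Z \<longlonglongrightarrow> 0"
    unfolding \<kappa>_def[abs_def] Z_def[abs_def] .
  have \<kappa>Z: "Re (\<kappa> n) = 0" "0 \<le> Re (Z n)" "Z n \<noteq> 0" for n using x0[of n] by (auto simp: \<kappa>_def Z_def)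
  note lims = whit_v_tendsto[OF \<kappa>l \<kappa>Z(1) Zl \<kappa>Z(2,3)] whit_v_plus_one_tendsto[OF \<kappa>l \<kappa>Z(1) Zl \<kappa>Z(2,3)]
    whit_norm_tendsto[OF \<kappa>l \<kappa>Z(1) Zl \<kappa>Z(2,3)]
  define \<Gamma> where "\<Gamma> = (Gamma (3/4) :: real)"
  have \<Gamma>0: "\<Gamma> > 0" by (simp add: \<Gamma>_def Gamma_real_pos)
  have Gl: "(\<lambda>n. whit_norm (3/4 - \<kappa> n)) \<longlonglongrightarrow> of_real \<Gamma>" using lims(3) by (simp add: \<Gamma>_def)
  define C where "C = pi / (4 * \<bar>\<Gamma>\<bar>\<^sup>2)"
  have C0: "C > 0" using \<Gamma>0 by (simp add: C_def)
  define y where "y n = x n * sqrt (4 * s n + x n)" for n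
  \<comment> \<open>\<open>P\<close> stands for \<open>n_SJ\<close> times \<open>y\<close>. As
    \<open>x\<close>, \<open>s\<close> and \<open>y\<close> tend to 0, only the \<open>SJ_B\<close>
    term survives, and its limit is \<open>C\<close>.\<close>
  define P where "P n = 1/4 * exp (- pi * s n) * ((4 * s n + x n) * x n * SJ_A (\<kappa> n) (Z n) + SJ_B (\<kappa> n) (Z n)) - 1/2 * y n" for n
  have y0: "y n > 0" for n using x0[of n] s0[of n] by (simp add: y_def)
  have "y \<longlonglongrightarrow> 0 * sqrt (4 * 0 + 0)" unfolding y_def by (intro tendsto_intros xl sl)
  then have yl: "y \<longlonglongrightarrow> 0" by simp
  have Al: "(\<lambda>n. SJ_A (\<kappa> n) (Z n)) \<longlonglongrightarrow> (norm (of_real (sqrt pi) / of_real \<Gamma> :: complex))\<^sup>2"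
    unfolding SJ_A_def using \<Gamma>0 by (intro tendsto_intros lims Gl) auto
  have Bl: "(\<lambda>n. SJ_B (\<kappa> n) (Z n)) \<longlonglongrightarrow>
      (norm (((0 + 1) * of_real (sqrt pi) + 2 * (1/4 - 0) * 0) / of_real \<Gamma> :: complex))\<^sup>2"
    unfolding SJ_B_def using \<Gamma>0 by (intro tendsto_intros lims Gl \<kappa>l Zl) auto
  have "P \<longlonglongrightarrow> 1/4 * exp (- pi * 0) * ((4 * 0 + 0) * 0 * (norm (of_real (sqrt pi) / of_real \<Gamma> :: complex))\<^sup>2
     + (norm (((0 + 1) * of_real (sqrt pi) + 2 * (1/4 - 0) * 0) / of_real \<Gamma> :: complex))\<^sup>2) - 1/2 * 0"
    unfolding P_def by (intro tendsto_intros xl sl yl Al Bl)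
  then have Pl: "P \<longlonglongrightarrow> C" using \<Gamma>0 by (simp add: C_def norm_divide power_divide)
  define u where "u n = y n / P n" for n
  have "u \<longlonglongrightarrow> 0 / C" unfolding u_def using C0 by (intro tendsto_divide yl Pl) auto
  then have ul: "u \<longlonglongrightarrow> 0" by simp
  have Ppos: "\<forall>\<^sub>F n in sequentially. P n > 0" using order_tendstoD(1)[OF Pl C0] .
  have Gnz: "\<forall>\<^sub>F n in sequentially. whit_norm (3/4 - \<kappa> n) \<noteq> 0"
    using tendsto_imp_eventually_ne[OF Gl] \<Gamma>0 by simp
  \<comment> \<open>The limit of u / ln(1 + u) is taken at a punctured neighbourhood of 0, so
    \<open>u\<close> must avoid 0.\<close>
  have unz: "\<forall>\<^sub>F n in sequentially. u n \<noteq> 0"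
    using Ppos
  proof eventually_elim
    case (elim n)
    then show ?case using y0[of n] by (simp add: u_def)
  qed
  have "filterlim u (at 0) sequentially"
    unfolding filterlim_at using ul unz by simp
  moreover have "((\<lambda>u::real. u / ln (1 + u)) \<longlongrightarrow> 1) (at 0)" by real_asymp
  ultimately have "(\<lambda>n. u n / ln (1 + u n)) \<longlonglongrightarrow> 1" by (rule filterlim_compose[rotated])
  then have "(\<lambda>n. P n / C * (u n / ln (1 + u n))) \<longlonglongrightarrow> C / C * 1"
    using C0 by (intro tendsto_intros Pl) auto
  then have "(\<lambda>n. P n / C * (u n / ln (1 + u n))) \<longlonglongrightarrow> 1" using C0 by simp
  \<comment> \<open>Positivity of \<open>P\<close> and nonvanishing of \<open>whit_norm\<close> are
    inferred from their positive limits, hence hold only eventually.\<close>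
  moreover have "\<forall>\<^sub>F n in sequentially. P n / C * (u n / ln (1 + u n)) =
      T_SJ (m n) (H n) (p n) / (C * (H n powr (3/2) / sqrt (m n)))"
    using Ppos Gnz
  proof eventually_elim
    case (elim n)
    have "n_SJ (m n) (H n) (p n) * (x n * sqrt (4 * s n + x n)) = P n"
      unfolding P_def y_def
      by (rule n_SJ_eq) (use pos[of n] elim in \<open>auto simp: x_def s_def \<kappa>_def Z_def\<close>)
    from T_SJ_ratio_eq[OF pos[of n] x_def s_def this elim(1), of C]
    show ?case by (simp add: u_def y_def)
  qed
  ultimately have "(\<lambda>n. T_SJ (m n) (H n) (p n) / (C * (H n powr (3/2) / sqrt (m n)))) \<longlonglongrightarrow> 1"
    by (rule Lim_transform_eventually)
  then show "(\<lambda>n. case X n of (m, H, p) \<Rightarrow> T_SJ m H p /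
            (pi / (4 * \<bar>Gamma (3 / 4 :: real)\<bar>\<^sup>2) * (H powr (3 / 2) / sqrt m))) \<longlonglongrightarrow> 1"
    by (simp add: X C_def \<Gamma>_def)
qed

end
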